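(* Assume that the functions $\boldsymbol u$ and $\boldsymbol G$ are real and smooth. For any positive integers $N$ and $n$, any fixed initial condition $\boldsymbol X_0=\boldsymbol x_0\in\mathbb R^v$ and any $v$-dimensional multi-index $\boldsymbol r$ with $|\boldsymbol r|\ge1$, we have the identity $$\mathbb E\big[\Delta\hat{\boldsymbol W}^{\boldsymbol r}_n(\boldsymbol x_0)\big]=\sum_{|\boldsymbol s|+|\boldsymbol r'|=1}^{N}a^{(\boldsymbol s,\boldsymbol r')}_{\boldsymbol r,n,N}\big(\hat{\boldsymbol x}^C_{n-1}(\boldsymbol x_0),t_{n-1}\big)\,\mathbb E\big[\Delta\boldsymbol W^{\boldsymbol s}_n\big]\,\mathbb E\big[\Delta\hat{\boldsymbol W}^{\boldsymbol r'}_{n-1}(\boldsymbol x_0)\big]+\mathbb E\big[\boldsymbol R^{(\boldsymbol r)}_{n,N}\big(\Delta\boldsymbol W_n,\Delta\hat{\boldsymbol W}_{n-1}(\boldsymbol x_0)\big)\big],$$ where $\boldsymbol R^{(\boldsymbol r)}_{n,N}$ is the remainder term of the expansion and $a^{(\boldsymbol s,\boldsymbol r')}_{\boldsymbol r,n,N}(\hat{\boldsymbol x}^C_{n-1}(\boldsymbol x_0),t_{n-1})$ are the constant coefficients of the expansion of the effective noise monomial. Moreover, if there are finite constants $A^{(j)}_n$ such that $|\Delta W^{(j)}_n|<A^{(j)}_n$ for every $n\ge1$ and $j=1,\dots,d$, then $$\lim_{N\to\infty}\mathbb E\big[\boldsymbol R^{(\boldsymbol r)}_{n,N}\big(\Delta\boldsymbol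 W_n,\Delta\hat{\boldsymbol W}_{n-1}(\boldsymbol x_0)\big)\big]=0.$$
   Context: Setting: $\boldsymbol u:\mathbb R^v\times[0,\infty)\to\mathbb R^v$ (components $u^{(k)}$) and $\boldsymbol G:\mathbb R^v\times[0,\infty)\to\mathbb R^{v\times d}$ (entries $G^{(k,j)}$) are the drift and diffusion coefficients of the SDE $d\boldsymbol X(t)=\boldsymbol u(\boldsymbol X,t)\,dt+\boldsymbol G(\boldsymbol X,t)\,d\boldsymbol W(t)$, where $\boldsymbol W$ is a $d$-dimensional stochastic process with independent increments. Let $h>0$, $t_n=t_0+nh$, $\Delta\boldsymbol W_n=\boldsymbol W(t_n)-\boldsymbol W(t_{n-1})$ with components $\Delta W^{(j)}_n$; the random vectors $\Delta\boldsymbol W_1,\Delta\boldsymbol W_2,\dots$ are independent. Euler–Maruyama sequence: $\hat{\boldsymbol X}_n=\hat{\boldsymbol X}_{n-1}+h\boldsymbol u(\hat{\boldsymbol X}_{n-1},t_{n-1})+\boldsymbol G(\hat{\boldsymbol X}_{n-1},t_{n-1})\Delta\boldsymbol W_n$, $n\ge1$, with $\hat{\boldsymbol X}_0=\boldsymbol x_0$; write $\hat{\boldsymbol X}_n(\boldsymbol x_0)$. Central part: $\hat{\boldsymbol x}^C_n(\boldsymbol x_0)=\hat{\boldsymbol x}^C_{n-1}(\boldsymbol x_0)+h\boldsymbol u(\hat{\boldsymbol x}^C_{n-1}(\boldsymbol x_0),t_{n-1})$, $\hat{\boldsymbol x}^C_0(\boldsymbol x_0)=\boldsymbol x_0$.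 Effective noise: $\Delta\hat{\boldsymbol W}_n(\boldsymbol x_0)=\hat{\boldsymbol X}_n(\boldsymbol x_0)-\hat{\boldsymbol x}^C_n(\boldsymbol x_0)$. Multi-index notation: $\boldsymbol r,\boldsymbol r'$ are $v$-dimensional and $\boldsymbol s$ is $d$-dimensional, with non-negative integer entries; $|\boldsymbol r|$ is the sum of the entries, $\boldsymbol r!=\prod_k r^{(k)}!$, $\boldsymbol a^{\boldsymbol r}=\prod_k(a^{(k)})^{r^{(k)}}$ (equal to $1$ when $|\boldsymbol r|=0$). The sum $\sum_{|\boldsymbol s|+|\boldsymbol r'|=1}^N$ is over all pairs $(\boldsymbol s,\boldsymbol r')$ with $1\le|\boldsymbol s|+|\boldsymbol r'|\le N$. Expansion: for each $k$ the effective noise component satisfies $$\begin{aligned}\Delta\hat W^{(k)}_n(\boldsymbol x_0)={}&\Delta\hat W^{(k)}_{n-1}(\boldsymbol x_0)+h\sum_{1\le|\boldsymbol q|\le N}\frac1{\boldsymbol q!}\frac{\partial^{|\boldsymbol q|}u^{(k)}}{\partial\boldsymbol x^{\boldsymbol q}}(\hat{\boldsymbol x}^C_{n-1}(\boldsymbol x_0),t_{n-1})\Delta\hat{\boldsymbol W}^{\boldsymbol q}_{n-1}(\boldsymbol x_0)\\&+\sum_{0\le|\boldsymbol q|\le N-1}\sum_{j=1}^d\frac1{\boldsymbol q!}\frac{\partial^{|\boldsymbol q|}G^{(k,j)}}{\partial\boldsymbol x^{\boldsymbol q}}(\hat{\boldsymbol x}^C_{n-1}(\boldsymbol x_0),t_{n-1})\Delta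 W^{(j)}_n\Delta\hat{\boldsymbol W}^{\boldsymbol q}_{n-1}(\boldsymbol x_0)+R^{(k)}_{n,N},\end{aligned}$$ where $R^{(k)}_{n,N}$ is the remainder coming from the Taylor expansions of $u^{(k)}$ (order $N$) and $G^{(k,j)}$ (order $N-1$) around $\hat{\boldsymbol x}^C_{n-1}(\boldsymbol x_0)$. The coefficients $a^{(\boldsymbol s,\boldsymbol r')}_{\boldsymbol r,n,N}(\hat{\boldsymbol x}^C_{n-1}(\boldsymbol x_0),t_{n-1})$ are the (deterministic) coefficients of $\Delta\boldsymbol W_n^{\boldsymbol s}\,\Delta\hat{\boldsymbol W}_{n-1}^{\boldsymbol r'}$, $1\le|\boldsymbol s|+|\boldsymbol r'|\le N$, obtained by multiplying out $\Delta\hat{\boldsymbol W}_n^{\boldsymbol r}=\prod_k(\Delta\hat W_n^{(k)})^{r^{(k)}}$ using the polynomial parts of these expansions and truncating to total degree at most $N$ in $(\Delta\boldsymbol W_n,\Delta\hat{\boldsymbol W}_{n-1})$. The remainder $\boldsymbol R^{(\boldsymbol r)}_{n,N}(\Delta\boldsymbol W_n,\Delta\hat{\boldsymbol W}_{n-1}(\boldsymbol x_0))$ is the difference between $\Delta\hat{\boldsymbol W}_n^{\boldsymbol r}(\boldsymbol x_0)$ and this truncated polynomial in $(\Delta\boldsymbol W_n,\Delta\hat{\boldsymbol W}_{n-1}(\boldsymbol x_0))$.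
   Formalization: The limit is proved assuming also that the Taylor series of u and G at the central part converge absolutely to them on a box containing the previous effective noise a.s. (false for merely smooth u, e.g. exp(-1/x²)); the identity assumes the displayed expectations exist. *)

theory Defs
  imports "HOL-Probability.Probability" "HOL-Library.Poly_Mapping"
begin

section \<open>Multi-indices\<close>

type_synonym 'v mindex = "'v \<Rightarrow> nat"

definition mabs :: "'v::finite mindex \<Rightarrow> nat" where
  "mabs q = (\<Sum>k\<in>UNIV. q k)"

definition mfact :: "'v::finite mindex \<Rightarrow> real" where
  "mfact q = (\<Prod>k\<in>UNIV. fact (q k))"

definition mpow :: "real ^ 'v \<Rightarrow> 'v::finite mindex \<Rightarrow> real" where
  "mpow a q = (\<Prod>k\<in>UNIV. (a $ k) ^ q k)"

definition munit :: "'v \<Rightarrow> 'v mindex" where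
  "munit k = (\<lambda>i. of_bool (i = k))"

text \<open>All finite sums below range over subsets of such sets.\<close>

lemma finite_mabs_le: "finite {q :: 'v::finite mindex. mabs q \<le> N}"
proof (rule finite_subset)
  show "{q :: 'v mindex. mabs q \<le> N} \<subseteq> Pi\<^sub>E UNIV (\<lambda>_. {..N})"
  proof
    fix q :: "'v mindex" assume "q \<in> {q. mabs q \<le> N}"
    then have "q k \<le> N" for k
      using member_le_sum[of k UNIV q] by (simp add: mabs_def)
    then show "q \<in> Pi\<^sub>E UNIV (\<lambda>_. {..N})" by auto
  qed
qed (auto intro: finite_PiE)


section \<open>Partial derivatives and smooth functions\<close>

definition partial_deriv ::
    "'v::finite \<Rightarrow> (real ^ 'v \<Rightarrow> real) \<Rightarrow> real ^ 'v \<Rightarrow> real" where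
  "partial_deriv k f x = deriv (\<lambda>\<xi>. f (x + \<xi> *\<^sub>R axis k 1)) 0"

text \<open>The mixed partial of multi-index \<open>q\<close> differentiates \<open>q k\<close> times in the \<open>k\<close>-th variable.
  The order of differentiation is an arbitrary fixed one (a list with the right multiplicities,
  which exists by the next lemma); it is immaterial for smooth functions.\<close>

definition mixed_partial ::
    "'v::finite mindex \<Rightarrow> (real ^ 'v \<Rightarrow> real) \<Rightarrow> real ^ 'v \<Rightarrow> real" where
  "mixed_partial q f = foldr partial_deriv (SOME ks. \<forall>k. count_list ks k = q k) f"

lemma ex_list_count: "\<exists>ks. \<forall>k. count_list ks k = (q :: 'v::finite mindex) k"
proof -
  obtain ks where "mset ks = Abs_multiset q" using ex_mset by blast
  then have "count_list ks k = q k" for k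
    using count_mset[of ks k] by (simp add: Abs_multiset_inverse)
  then show ?thesis by blast
qed

text \<open>\<open>C\<^sup>\<infinity>\<close>: all iterated partial derivatives, in any order, exist and are continuous.\<close>

definition smooth_fun :: "(real ^ 'v::finite \<Rightarrow> real) \<Rightarrow> bool" where
  "smooth_fun f \<longleftrightarrow>
     (\<forall>ks. continuous_on UNIV (foldr partial_deriv ks f) \<and>
           (\<forall>k x. (\<lambda>\<xi>. foldr partial_deriv ks f (x + \<xi> *\<^sub>R axis k 1)) differentiable (at 0)))"

text \<open>The Taylor series of \<open>f\<close> at \<open>x\<close> converges to \<open>f\<close> on the closed box of half-widths \<open>\<rho>\<close>
  around \<open>x\<close>, as an unordered (hence absolutely convergent) sum over multi-indices.
  For a function that is merely \<open>C\<^sup>\<infinity>\<close> this can fail for every \<open>\<rho>\<close> with a positive entry, and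
  then the expectation of the remainder of the expansion below need not tend to \<open>0\<close> even for
  bounded noise.\<close>

definition taylor_converges_on_box ::
    "(real ^ 'v::finite \<Rightarrow> real) \<Rightarrow> real ^ 'v \<Rightarrow> real ^ 'v \<Rightarrow> bool" where
  "taylor_converges_on_box f x \<rho> \<longleftrightarrow>
     (\<forall>y. (\<forall>k. \<bar>y $ k\<bar> \<le> \<rho> $ k) \<longrightarrow>
        ((\<lambda>q. mixed_partial q f x / mfact q * mpow y q) has_sum f (x + y)) UNIV)"


section \<open>Driving noise and Euler--Maruyama sequence\<close>

definition independent_increments ::
    "'a measure \<Rightarrow> (real \<Rightarrow> 'a \<Rightarrow> real ^ 'd::finite) \<Rightarrow> bool" where
  "independent_increments M W \<longleftrightarrow>
     (\<forall>(m::nat) \<tau>. 0 \<le> \<tau> 0 \<and> (\<forall>i<m. \<tau> i < \<tau> (Suc i)) \<longrightarrow>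
        prob_space.indep_vars M (\<lambda>_. borel) (\<lambda>i \<omega>. W (\<tau> (Suc i)) \<omega> - W (\<tau> i) \<omega>) {..<m})"

definition grid :: "real \<Rightarrow> real \<Rightarrow> nat \<Rightarrow> real" where
  "grid t0 h n = t0 + real n * h"

text \<open>Used only for \<open>n \<ge> 1\<close>.\<close>

definition noise_incr ::
    "(real \<Rightarrow> 'a \<Rightarrow> real ^ 'd::finite) \<Rightarrow> real \<Rightarrow> real \<Rightarrow> nat \<Rightarrow> 'a \<Rightarrow> real ^ 'd" where
  "noise_incr W t0 h n \<omega> = W (grid t0 h n) \<omega> - W (grid t0 h (n - 1)) \<omega>"

primrec euler_maruyama ::
    "(real ^ 'v::finite \<Rightarrow> real \<Rightarrow> real ^ 'v) \<Rightarrow> (real ^ 'v \<Rightarrow> real \<Rightarrow> real ^ 'd::finite ^ 'v) \<Rightarrow>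
     (real \<Rightarrow> 'a \<Rightarrow> real ^ 'd) \<Rightarrow> real \<Rightarrow> real \<Rightarrow> real ^ 'v \<Rightarrow> nat \<Rightarrow> 'a \<Rightarrow> real ^ 'v" where
  "euler_maruyama u G W t0 h x0 0 \<omega> = x0"
| "euler_maruyama u G W t0 h x0 (Suc n) \<omega> =
     euler_maruyama u G W t0 h x0 n \<omega>
     + h *\<^sub>R u (euler_maruyama u G W t0 h x0 n \<omega>) (grid t0 h n)
     + G (euler_maruyama u G W t0 h x0 n \<omega>) (grid t0 h n) *v noise_incr W t0 h (Suc n) \<omega>"

primrec central_part ::
    "(real ^ 'v::finite \<Rightarrow> real \<Rightarrow> real ^ 'v) \<Rightarrow> real \<Rightarrow> real \<Rightarrow> real ^ 'v \<Rightarrow> nat \<Rightarrow> real ^ 'v" where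
  "central_part u t0 h x0 0 = x0"
| "central_part u t0 h x0 (Suc n) =
     central_part u t0 h x0 n + h *\<^sub>R u (central_part u t0 h x0 n) (grid t0 h n)"

definition eff_noise ::
    "(real ^ 'v::finite \<Rightarrow> real \<Rightarrow> real ^ 'v) \<Rightarrow> (real ^ 'v \<Rightarrow> real \<Rightarrow> real ^ 'd::finite ^ 'v) \<Rightarrow>
     (real \<Rightarrow> 'a \<Rightarrow> real ^ 'd) \<Rightarrow> real \<Rightarrow> real \<Rightarrow> real ^ 'v \<Rightarrow> nat \<Rightarrow> 'a \<Rightarrow> real ^ 'v" where
  "eff_noise u G W t0 h x0 n \<omega> = euler_maruyama u G W t0 h x0 n \<omega> - central_part u t0 h x0 n"


section \<open>Expansion of the effective noise\<close>

text \<open>Formal polynomials in \<open>d + v\<close> indeterminates, the components \<open>j\<close> of the current noise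
  increment (index \<open>Inl j\<close>) and the components \<open>k\<close> of the previous effective noise
  (index \<open>Inr k\<close>), are finitely supported maps from exponents to coefficients, multiplied by
  convolution.\<close>

definition expo :: "'d::finite mindex \<Rightarrow> 'v::finite mindex \<Rightarrow> ('d + 'v \<Rightarrow>\<^sub>0 nat)" where
  "expo s q = Abs_poly_mapping (case_sum s q)"

text \<open>The polynomial part of the expansion of the \<open>k\<close>-th effective noise component. The arguments
  \<open>x\<close> and \<open>t\<close> stand for the previous central part and the previous time.\<close>

definition noise_poly ::
    "(real ^ 'v::finite \<Rightarrow> real \<Rightarrow> real ^ 'v) \<Rightarrow> (real ^ 'v \<Rightarrow> real \<Rightarrow> real ^ 'd::finite ^ 'v) \<Rightarrow>
     real \<Rightarrow> nat \<Rightarrow> real ^ 'v \<Rightarrow> real \<Rightarrow> 'v \<Rightarrow> (('d + 'v \<Rightarrow>\<^sub>0 nat) \<Rightarrow>\<^sub>0 real)" where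
  "noise_poly u G h N x t k =
     Poly_Mapping.single (expo (\<lambda>_. 0) (munit k)) 1
     + (\<Sum>q | 1 \<le> mabs q \<and> mabs q \<le> N.
          Poly_Mapping.single (expo (\<lambda>_. 0) q)
            (h * (mixed_partial q (\<lambda>z. u z t $ k) x / mfact q)))
     + (\<Sum>q | mabs q \<le> N - 1. \<Sum>j\<in>UNIV.
          Poly_Mapping.single (expo (munit j) q)
            (mixed_partial q (\<lambda>z. G z t $ k $ j) x / mfact q))"

definition noise_coeff ::
    "(real ^ 'v::finite \<Rightarrow> real \<Rightarrow> real ^ 'v) \<Rightarrow> (real ^ 'v \<Rightarrow> real \<Rightarrow> real ^ 'd::finite ^ 'v) \<Rightarrow>
     real \<Rightarrow> nat \<Rightarrow> 'v mindex \<Rightarrow> 'd mindex \<Rightarrow> 'v mindex \<Rightarrow> real ^ 'v \<Rightarrow> real \<Rightarrow> real" where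
  "noise_coeff u G h N r s r' x t =
     Poly_Mapping.lookup (\<Prod>k\<in>UNIV. noise_poly u G h N x t k ^ r k) (expo s r')"

definition noise_remainder ::
    "(real ^ 'v::finite \<Rightarrow> real \<Rightarrow> real ^ 'v) \<Rightarrow> (real ^ 'v \<Rightarrow> real \<Rightarrow> real ^ 'd::finite ^ 'v) \<Rightarrow>
     (real \<Rightarrow> 'a \<Rightarrow> real ^ 'd) \<Rightarrow> real \<Rightarrow> real \<Rightarrow> real ^ 'v \<Rightarrow> 'v mindex \<Rightarrow> nat \<Rightarrow> nat \<Rightarrow> 'a \<Rightarrow> real" where
  "noise_remainder u G W t0 h x0 r n N \<omega> =
     mpow (eff_noise u G W t0 h x0 n \<omega>) r
     - (\<Sum>(s, r') | 1 \<le> mabs s + mabs r' \<and> mabs s + mabs r' \<le> N.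
          noise_coeff u G h N r s r' (central_part u t0 h x0 (n - 1)) (grid t0 h (n - 1))
          * mpow (noise_incr W t0 h n \<omega>) s
          * mpow (eff_noise u G W t0 h x0 (n - 1) \<omega>) r')"

end

theory Submission
  imports Defs
begin

text \<open>
  Fix the previous central part \<open>x\<close> and the previous time \<open>t\<close>.  One step of the scheme sends the
  current increment \<open>w\<close> and the previous effective noise \<open>y\<close> to the new effective noise
  \<open>noise_step\<close>, whose components have the polynomials \<open>noise_poly\<close> of degree at most \<open>N\<close> as Taylor
  approximants in \<open>(w, y)\<close>.

  The identity is linearity of the expectation together with independence: \<open>y\<close> is a measurable
  function of the earlier increments only (\<open>euler_path\<close>), so \<open>mpow w s\<close> and \<open>mpow y r'\<close> are independent
  and the expectation of each product splits (\<open>indep_noise_incr_eff_noise\<close>,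
  \<open>expectation_of_expansion\<close>).

  For the limit, the point is that the remainder is bounded uniformly in \<open>N\<close> and tends to \<open>0\<close> on the
  box \<open>|w| \<le> a\<close>, \<open>|y| \<le> \<rho>\<close> (\<open>truncated_expansion_converges\<close>); dominated convergence then
  applies.  Let \<open>P N\<close> be the product of the powers \<open>noise_poly N ^ r k\<close>.  The remainder splits into two
  parts.  The first is the error of \<open>P N\<close> itself, which tends to \<open>0\<close> because every factor converges.
  The second is the part of \<open>P N\<close> of degree above \<open>N\<close>, which truncation throws away.  To see that it
  is small, measure polynomials by the sum of the absolute values of their terms at the corner
  \<open>(a, \<rho>)\<close> of the box.  This norm is submultiplicative, and the \<open>noise_poly N\<close> form a Cauchy sequence
  for it, since Taylor series that converge unconditionally at \<open>\<rho>\<close> converge absolutely there.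
  Hence \<open>P N\<close> and \<open>P (N div R)\<close>, where \<open>R = |r|\<close>, are close in norm.  But for \<open>N \<ge> R\<close> the product
  \<open>P (N div R)\<close> has degree at most \<open>N\<close>, so the terms of \<open>P N\<close> above degree \<open>N\<close> all occur in the
  difference, and their total size tends to \<open>0\<close> (\<open>poly_tail_prod_tendsto_0\<close>).  No product of
  infinite series in several variables has to be formed.
\<close>

section \<open>Polynomials on a polydisc\<close>

text \<open>The weighted \<open>\<ell>\<^sup>1\<close> norm \<open>poly_norm b\<close> bounds the values on the polydisc of polyradius \<open>b\<close>;
  \<open>poly_tail b N\<close> is the share of this norm carried by the terms that truncation at total degree
  \<open>N\<close> removes.\<close>

definition mono_val :: "('i::finite \<Rightarrow> real) \<Rightarrow> ('i \<Rightarrow>\<^sub>0 nat) \<Rightarrow> real" where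
  "mono_val z m = (\<Prod>i\<in>UNIV. z i ^ Poly_Mapping.lookup m i)"

definition mono_deg :: "('i::finite \<Rightarrow>\<^sub>0 nat) \<Rightarrow> nat" where
  "mono_deg m = (\<Sum>i\<in>UNIV. Poly_Mapping.lookup m i)"

definition poly_val :: "('i::finite \<Rightarrow> real) \<Rightarrow> (('i \<Rightarrow>\<^sub>0 nat) \<Rightarrow>\<^sub>0 real) \<Rightarrow> real" where
  "poly_val z P = (\<Sum>m\<in>Poly_Mapping.keys P. Poly_Mapping.lookup P m * mono_val z m)"

definition poly_norm :: "('i::finite \<Rightarrow> real) \<Rightarrow> (('i \<Rightarrow>\<^sub>0 nat) \<Rightarrow>\<^sub>0 real) \<Rightarrow> real" where
  "poly_norm b P = (\<Sum>m\<in>Poly_Mapping.keys P. \<bar>Poly_Mapping.lookup P m\<bar> * mono_val b m)"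

definition poly_tail :: "('i::finite \<Rightarrow> real) \<Rightarrow> nat \<Rightarrow> (('i \<Rightarrow>\<^sub>0 nat) \<Rightarrow>\<^sub>0 real) \<Rightarrow> real" where
  "poly_tail b N P =
     (\<Sum>m | m \<in> Poly_Mapping.keys P \<and> N < mono_deg m. \<bar>Poly_Mapping.lookup P m\<bar> * mono_val b m)"

lemma mono_val_zero [simp]: "mono_val z 0 = 1"
  by (simp add: mono_val_def)

lemma mono_val_add: "mono_val z (m + m') = mono_val z m * mono_val z m'"
  by (simp add: mono_val_def lookup_add power_add prod.distrib)

lemma mono_val_nonneg: "(\<And>i. 0 \<le> b i) \<Longrightarrow> 0 \<le> mono_val b m"
  by (simp add: mono_val_def prod_nonneg)

lemma abs_mono_val_le:
  assumes "\<And>i. \<bar>z i\<bar> \<le> b i"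
  shows "\<bar>mono_val z m\<bar> \<le> mono_val b m"
  unfolding mono_val_def abs_prod power_abs
  by (intro prod_mono conjI power_mono assms) auto

lemma mono_deg_add: "mono_deg (m + m') = mono_deg m + mono_deg m'"
  by (simp add: mono_deg_def lookup_add sum.distrib)

lemma mono_deg_zero_iff [simp]: "mono_deg m = 0 \<longleftrightarrow> m = 0"
  by (auto simp: mono_deg_def intro!: poly_mapping_eqI)

text \<open>Evaluation at the origin reads off the constant coefficient, which makes that coefficient
  multiplicative.\<close>

lemma mono_val_origin: "mono_val (\<lambda>_. 0) m = (if m = 0 then 1 else 0)"
proof (cases "m = 0")
  case False
  then obtain i where "Poly_Mapping.lookup m i \<noteq> 0"
    by (metis lookup_zero poly_mapping_eqI)
  with False show ?thesis
    by (auto simp: mono_val_def intro!: prod_zero)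
qed simp

lemma poly_as_sum_of_terms:
  "(\<Sum>m\<in>Poly_Mapping.keys P. Poly_Mapping.single m (Poly_Mapping.lookup P m)) = P"
  by (intro poly_mapping_eqI)
     (auto simp: lookup_sum lookup_single when_def sum.delta in_keys_iff)

lemma poly_val_superset:
  assumes "finite S" "Poly_Mapping.keys P \<subseteq> S"
  shows "poly_val z P = (\<Sum>m\<in>S. Poly_Mapping.lookup P m * mono_val z m)"
  unfolding poly_val_def by (intro sum.mono_neutral_left assms) (auto simp: in_keys_iff)

lemma poly_norm_superset:
  assumes "finite S" "Poly_Mapping.keys P \<subseteq> S"
  shows "poly_norm b P = (\<Sum>m\<in>S. \<bar>Poly_Mapping.lookup P m\<bar> * mono_val b m)"
  unfolding poly_norm_def by (intro sum.mono_neutral_left assms) (auto simp: in_keys_iff)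

lemma poly_val_zero [simp]: "poly_val z 0 = 0"
  by (simp add: poly_val_def)

lemma poly_val_single [simp]: "poly_val z (Poly_Mapping.single m c) = c * mono_val z m"
  by (simp add: poly_val_def)

lemma poly_val_one [simp]: "poly_val z 1 = 1"
  by (simp add: poly_val_def lookup_one)

lemma poly_val_add: "poly_val z (P + Q) = poly_val z P + poly_val z Q"
proof -
  let ?S = "Poly_Mapping.keys P \<union> Poly_Mapping.keys Q"
  have "poly_val z (P + Q) = (\<Sum>m\<in>?S. Poly_Mapping.lookup (P + Q) m * mono_val z m)"
    by (intro poly_val_superset keys_add) auto
  moreover have "poly_val z P = (\<Sum>m\<in>?S. Poly_Mapping.lookup P m * mono_val z m)"
    "poly_val z Q = (\<Sum>m\<in>?S. Poly_Mapping.lookup Q m * mono_val z m)"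
    by (auto intro!: poly_val_superset)
  ultimately show ?thesis
    by (simp add: lookup_add ring_distribs sum.distrib)
qed

lemma poly_val_sum: "poly_val z (\<Sum>i\<in>I. P i) = (\<Sum>i\<in>I. poly_val z (P i))"
  by (induction I rule: infinite_finite_induct) (simp_all add: poly_val_add)

text \<open>This form of the convolution product makes both evaluation and norm of a product visible
  term by term.\<close>

lemma mult_as_sum_of_terms:
  "P * Q = (\<Sum>m\<in>Poly_Mapping.keys P. \<Sum>m'\<in>Poly_Mapping.keys Q.
     Poly_Mapping.single (m + m') (Poly_Mapping.lookup P m * Poly_Mapping.lookup Q m'))"
  by (subst (1) poly_as_sum_of_terms[of P, symmetric], subst (1) poly_as_sum_of_terms[of Q, symmetric])
     (simp only: sum_product mult_single)

lemma poly_val_mult: "poly_val z (P * Q) = poly_val z P * poly_val z Q"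
  by (subst mult_as_sum_of_terms)
     (simp add: poly_val_sum mono_val_add, simp add: poly_val_def sum_product mult_ac)

lemma poly_val_power: "poly_val z (P ^ n) = poly_val z P ^ n"
  by (induction n) (simp_all add: poly_val_mult)

lemma poly_val_prod: "poly_val z (\<Prod>i\<in>I. P i) = (\<Prod>i\<in>I. poly_val z (P i))"
  by (induction I rule: infinite_finite_induct) (simp_all add: poly_val_mult)

lemma poly_val_origin: "poly_val (\<lambda>_. 0) P = Poly_Mapping.lookup P 0"
  by (auto simp: poly_val_def mono_val_origin in_keys_iff if_distrib cong: if_cong)

lemma finite_mono_deg_le: "finite {m :: 'i::finite \<Rightarrow>\<^sub>0 nat. mono_deg m \<le> N}"
proof -
  have "{m :: 'i \<Rightarrow>\<^sub>0 nat. mono_deg m \<le> N} = Poly_Mapping.lookup -` {q. mabs q \<le> N}"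
    by (auto simp: mono_deg_def mabs_def)
  then show ?thesis
    using finite_vimageI[OF finite_mabs_le, of Poly_Mapping.lookup N]
    by (simp add: inj_def poly_mapping_eqI)
qed

lemma poly_norm_single [simp]: "poly_norm b (Poly_Mapping.single m c) = \<bar>c\<bar> * mono_val b m"
  by (simp add: poly_norm_def)

lemma poly_norm_zero [simp]: "poly_norm b 0 = 0"
  by (simp add: poly_norm_def)

lemma poly_norm_one [simp]: "poly_norm b 1 = 1"
  by (simp add: poly_norm_def lookup_one)

context
  fixes b :: "'i::finite \<Rightarrow> real"
  assumes b_nonneg: "\<And>i. 0 \<le> b i"
begin

lemma poly_norm_nonneg: "0 \<le> poly_norm b P"
  by (simp add: poly_norm_def sum_nonneg mono_val_nonneg b_nonneg)

lemma poly_norm_add: "poly_norm b (P + Q) \<le> poly_norm b P + poly_norm b Q"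
proof -
  let ?S = "Poly_Mapping.keys P \<union> Poly_Mapping.keys Q"
  have "poly_norm b (P + Q) = (\<Sum>m\<in>?S. \<bar>Poly_Mapping.lookup (P + Q) m\<bar> * mono_val b m)"
    by (intro poly_norm_superset keys_add) auto
  also have "\<dots> \<le> (\<Sum>m\<in>?S. \<bar>Poly_Mapping.lookup P m\<bar> * mono_val b m
      + \<bar>Poly_Mapping.lookup Q m\<bar> * mono_val b m)"
    by (intro sum_mono)
       (metis abs_triangle_ineq b_nonneg distrib_right lookup_add mono_val_nonneg mult_right_mono)
  also have "\<dots> = poly_norm b P + poly_norm b Q"
    by (simp add: sum.distrib poly_norm_superset[of ?S])
  finally show ?thesis .
qed

lemma poly_norm_sum: "poly_norm b (\<Sum>i\<in>I. P i) \<le> (\<Sum>i\<in>I. poly_norm b (P i))"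
proof (induction I rule: infinite_finite_induct)
  case (insert i I)
  then show ?case using poly_norm_add[of "P i" "\<Sum>i\<in>I. P i"] by simp
qed simp_all

lemma poly_norm_mult: "poly_norm b (P * Q) \<le> poly_norm b P * poly_norm b Q"
proof -
  let ?c = "\<lambda>m m'. Poly_Mapping.single (m + m') (Poly_Mapping.lookup P m * Poly_Mapping.lookup Q m')"
  have "poly_norm b (P * Q) =
      poly_norm b (\<Sum>m\<in>Poly_Mapping.keys P. \<Sum>m'\<in>Poly_Mapping.keys Q. ?c m m')"
    by (subst mult_as_sum_of_terms) simp
  also have "\<dots> \<le> (\<Sum>m\<in>Poly_Mapping.keys P. \<Sum>m'\<in>Poly_Mapping.keys Q. poly_norm b (?c m m'))"
    by (rule order_trans[OF poly_norm_sum sum_mono[OF poly_norm_sum]])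
  also have "\<dots> = poly_norm b P * poly_norm b Q"
    unfolding poly_norm_single unfolding poly_norm_def
    by (simp add: sum_product mono_val_add abs_mult mult_ac)
  finally show ?thesis .
qed

lemma abs_poly_val_le:
  assumes "\<And>i. \<bar>z i\<bar> \<le> b i"
  shows "\<bar>poly_val z P\<bar> \<le> poly_norm b P"
  unfolding poly_val_def poly_norm_def
  by (rule order_trans[OF sum_abs])
     (auto simp: abs_mult intro!: sum_mono mult_left_mono abs_mono_val_le assms)

text \<open>Subtracting a polynomial of degree at most \<open>N\<close> does not change the coefficients of degree
  above \<open>N\<close>, so these all show up in the difference.\<close>

lemma poly_tail_le_norm_diff:
  assumes "\<And>m. m \<in> Poly_Mapping.keys Q \<Longrightarrow> mono_deg m \<le> N"
  shows "poly_tail b N P \<le> poly_norm b (P - Q)"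
proof -
  have Q0: "Poly_Mapping.lookup Q m = 0" if "N < mono_deg m" for m
    using assms[of m] that by (auto simp: in_keys_iff)
  have "poly_tail b N P = (\<Sum>m | m \<in> Poly_Mapping.keys P \<and> N < mono_deg m.
      \<bar>Poly_Mapping.lookup (P - Q) m\<bar> * mono_val b m)"
    unfolding poly_tail_def by (intro sum.cong) (auto simp: lookup_minus Q0)
  also have "\<dots> \<le> poly_norm b (P - Q)"
    unfolding poly_norm_def
    by (intro sum_mono2) (auto simp: in_keys_iff lookup_minus Q0 mono_val_nonneg b_nonneg)
  finally show ?thesis .
qed

lemma poly_tail_nonneg: "0 \<le> poly_tail b N P"
  by (simp add: poly_tail_def sum_nonneg mono_val_nonneg b_nonneg)

text \<open>Without a constant term, the only terms missing from the truncation are those of degree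
  above \<open>N\<close>.\<close>

lemma abs_poly_val_minus_truncation_le:
  assumes z: "\<And>i. \<bar>z i\<bar> \<le> b i" and P0: "Poly_Mapping.lookup P 0 = 0"
  shows "\<bar>poly_val z P - (\<Sum>m | 1 \<le> mono_deg m \<and> mono_deg m \<le> N.
           Poly_Mapping.lookup P m * mono_val z m)\<bar> \<le> poly_tail b N P"
proof -
  let ?f = "\<lambda>m. Poly_Mapping.lookup P m * mono_val z m"
  let ?low = "{m. 1 \<le> mono_deg m \<and> mono_deg m \<le> N}"
  let ?high = "{m. m \<in> Poly_Mapping.keys P \<and> N < mono_deg m}"
  have fin: "finite ?low"
    by (rule finite_subset[OF _ finite_mono_deg_le[of N]]) auto
  have sub: "Poly_Mapping.keys P \<subseteq> ?low \<union> ?high"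
  proof
    fix m assume m: "m \<in> Poly_Mapping.keys P"
    then have "m \<noteq> 0"
      using P0 by (auto simp: in_keys_iff)
    then have "mono_deg m \<noteq> 0"
      by simp
    then have "1 \<le> mono_deg m"
      by linarith
    with m show "m \<in> ?low \<union> ?high" by auto
  qed
  have "poly_val z P = sum ?f (?low \<union> ?high)"
    by (rule poly_val_superset[OF _ sub]) (use fin in auto)
  also have "\<dots> = sum ?f ?low + sum ?f ?high"
    by (rule sum.union_disjoint) (use fin in auto)
  finally have "\<bar>poly_val z P - sum ?f ?low\<bar> = \<bar>sum ?f ?high\<bar>"
    by simp
  also have "\<dots> \<le> poly_tail b N P"
    unfolding poly_tail_def
    by (rule order_trans[OF sum_abs])
       (auto simp: abs_mult intro!: sum_mono mult_left_mono abs_mono_val_le z)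
  finally show ?thesis .
qed

text \<open>Boundedness is part of the relation so that it is preserved by products.\<close>

definition asym_close ::
    "(nat \<Rightarrow> (('i \<Rightarrow>\<^sub>0 nat) \<Rightarrow>\<^sub>0 real)) \<Rightarrow> (nat \<Rightarrow> (('i \<Rightarrow>\<^sub>0 nat) \<Rightarrow>\<^sub>0 real)) \<Rightarrow> bool" where
  "asym_close p q \<longleftrightarrow> (\<exists>C. \<forall>N. poly_norm b (p N) \<le> C \<and> poly_norm b (q N) \<le> C) \<and>
     (\<lambda>N. poly_norm b (p N - q N)) \<longlonglongrightarrow> 0"

lemma asym_close_one: "asym_close (\<lambda>_. 1) (\<lambda>_. 1)"
  by (auto simp: asym_close_def)

lemma asym_close_mult:
  assumes "asym_close p q" "asym_close p' q'"
  shows "asym_close (\<lambda>N. p N * p' N) (\<lambda>N. q N * q' N)"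
proof -
  obtain C where C: "\<And>N. poly_norm b (p N) \<le> C" "\<And>N. poly_norm b (q N) \<le> C"
    using assms(1) by (auto simp: asym_close_def)
  obtain C' where C': "\<And>N. poly_norm b (p' N) \<le> C'" "\<And>N. poly_norm b (q' N) \<le> C'"
    using assms(2) by (auto simp: asym_close_def)
  have *: "poly_norm b (P * Q) \<le> D * E"
    if "poly_norm b P \<le> D" "poly_norm b Q \<le> E" for P Q D E
    using that poly_norm_mult[of P Q] poly_norm_nonneg
    by (meson mult_mono order_trans)
  have le: "poly_norm b (p N * p' N - q N * q' N)
      \<le> C * poly_norm b (p' N - q' N) + poly_norm b (p N - q N) * C'" for N
  proof -
    have "p N * p' N - q N * q' N = p N * (p' N - q' N) + (p N - q N) * q' N"
      by (simp add: algebra_simps)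
    then show ?thesis
      using poly_norm_add[of "p N * (p' N - q' N)" "(p N - q N) * q' N"]
        *[OF C(1) order_refl, of N "p' N - q' N"] *[OF order_refl C'(2), of "p N - q N" N]
      by simp
  qed
  have lim: "(\<lambda>N. C * poly_norm b (p' N - q' N) + poly_norm b (p N - q N) * C') \<longlonglongrightarrow> C * 0 + 0 * C'"
    using assms by (intro tendsto_intros) (auto simp: asym_close_def)
  have "(\<lambda>N. poly_norm b (p N * p' N - q N * q' N)) \<longlonglongrightarrow> 0"
    by (rule tendsto_sandwich[OF always_eventually always_eventually tendsto_const])
       (use le poly_norm_nonneg lim in auto)
  moreover have "\<forall>N. poly_norm b (p N * p' N) \<le> C * C' \<and> poly_norm b (q N * q' N) \<le> C * C'"
    using * C C' by blast
  ultimately show ?thesis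
    unfolding asym_close_def by blast
qed

lemma asym_close_power: "asym_close p q \<Longrightarrow> asym_close (\<lambda>N. p N ^ n) (\<lambda>N. q N ^ n)"
  by (induction n) (auto intro: asym_close_one asym_close_mult)

lemma asym_close_prod:
  assumes "\<And>k. k \<in> K \<Longrightarrow> asym_close (p k) (q k)"
  shows "asym_close (\<lambda>N. \<Prod>k\<in>K. p k N) (\<lambda>N. \<Prod>k\<in>K. q k N)"
  using assms
  by (induction K rule: infinite_finite_induct) (auto intro: asym_close_one asym_close_mult)

end

definition deg_le :: "nat \<Rightarrow> (('i::finite \<Rightarrow>\<^sub>0 nat) \<Rightarrow>\<^sub>0 real) \<Rightarrow> bool" where
  "deg_le d P \<longleftrightarrow> (\<forall>m\<in>Poly_Mapping.keys P. mono_deg m \<le> d)"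

lemma deg_le_zero: "deg_le d 0"
  by (simp add: deg_le_def)

lemma deg_le_one: "deg_le 0 1"
  by (auto simp: deg_le_def)

lemma deg_le_mult: "deg_le d P \<Longrightarrow> deg_le e Q \<Longrightarrow> deg_le (d + e) (P * Q)"
  using keys_mult[of P Q] by (fastforce simp: deg_le_def mono_deg_add intro: add_mono)

lemma deg_le_power: "deg_le d P \<Longrightarrow> deg_le (d * n) (P ^ n)"
  by (induction n) (auto intro: deg_le_one deg_le_mult)

lemma deg_le_prod: "(\<And>k. k \<in> K \<Longrightarrow> deg_le (d k) (P k)) \<Longrightarrow> deg_le (\<Sum>k\<in>K. d k) (\<Prod>k\<in>K. P k)"
  by (induction K rule: infinite_finite_induct) (auto intro: deg_le_one deg_le_mult)

lemma deg_le_add: "deg_le d P \<Longrightarrow> deg_le d Q \<Longrightarrow> deg_le d (P + Q)"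
  using keys_add[of P Q] by (fastforce simp: deg_le_def)

lemma deg_le_sum: "(\<And>i. i \<in> I \<Longrightarrow> deg_le d (P i)) \<Longrightarrow> deg_le d (\<Sum>i\<in>I. P i)"
  by (induction I rule: infinite_finite_induct) (auto intro: deg_le_add deg_le_zero)

lemma deg_le_single: "mono_deg m \<le> d \<Longrightarrow> deg_le d (Poly_Mapping.single m c)"
  by (simp add: deg_le_def)

text \<open>With \<open>R = |r|\<close> and \<open>N \<ge> R\<close>, the product of the \<open>(N div R)\<close>-th approximants has degree at most \<open>N\<close>; it
  is close in norm to the product of the \<open>N\<close>-th ones when the approximants are Cauchy.  So the
  latter product has little mass above degree \<open>N\<close>.\<close>

lemma poly_tail_prod_tendsto_0:
  fixes b :: "'i::finite \<Rightarrow> real" and p :: "'k::finite \<Rightarrow> nat \<Rightarrow> (('i \<Rightarrow>\<^sub>0 nat) \<Rightarrow>\<^sub>0 real)"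
    and r :: "'k \<Rightarrow> nat"
  assumes b: "\<And>i. 0 \<le> b i"
    and R: "1 \<le> (\<Sum>k\<in>UNIV. r k)"
    and bounded: "\<And>k N. poly_norm b (p k N) \<le> C k"
    and cauchy: "\<And>k. (\<lambda>N. poly_norm b (p k N - p k (N div (\<Sum>k\<in>UNIV. r k)))) \<longlonglongrightarrow> 0"
    and deg: "\<And>k N. 1 \<le> N \<Longrightarrow> deg_le N (p k N)"
  shows "(\<lambda>N. poly_tail b N (\<Prod>k\<in>UNIV. p k N ^ r k)) \<longlonglongrightarrow> 0"
proof -
  define R where "R = (\<Sum>k\<in>UNIV. r k)"
  define Q where "Q N = (\<Prod>k\<in>UNIV. p k (N div R) ^ r k)" for N
  have "asym_close b (\<lambda>N. \<Prod>k\<in>UNIV. p k N ^ r k) Q"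
    unfolding Q_def using bounded cauchy
    by (intro asym_close_prod asym_close_power b) (auto simp: asym_close_def[OF b] R_def)
  then have lim: "(\<lambda>N. poly_norm b ((\<Prod>k\<in>UNIV. p k N ^ r k) - Q N)) \<longlonglongrightarrow> 0"
    by (simp add: asym_close_def[OF b])
  have le: "poly_tail b N (\<Prod>k\<in>UNIV. p k N ^ r k) \<le> poly_norm b ((\<Prod>k\<in>UNIV. p k N ^ r k) - Q N)"
    if "R \<le> N" for N
  proof (rule poly_tail_le_norm_diff[OF b])
    have "1 \<le> N div R" using that R by (simp add: R_def Suc_le_eq div_greater_zero_iff)
    then have "deg_le (\<Sum>k\<in>UNIV. (N div R) * r k) (Q N)"
      unfolding Q_def by (intro deg_le_prod deg_le_power deg)
    moreover have "(\<Sum>k\<in>UNIV. (N div R) * r k) \<le> N"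
      by (simp add: sum_distrib_left[symmetric] R_def[symmetric])
    ultimately show "m \<in> Poly_Mapping.keys (Q N) \<Longrightarrow> mono_deg m \<le> N" for m
      by (auto simp: deg_le_def)
  qed
  show ?thesis
    by (rule tendsto_sandwich[OF _ _ tendsto_const lim])
       (auto simp: poly_tail_nonneg b eventually_sequentially intro!: exI[of _ R] le)
qed

section \<open>The expansion of the effective noise\<close>

definition joint :: "real ^ 'd::finite \<Rightarrow> real ^ 'v::finite \<Rightarrow> 'd + 'v \<Rightarrow> real" where
  "joint w y = case_sum (($) w) (($) y)"

lemma lookup_expo: "Poly_Mapping.lookup (expo s q) = case_sum s q"
  by (simp add: expo_def)

lemma prod_over_sum_type:
  "(\<Prod>i\<in>(UNIV :: ('d::finite + 'v::finite) set). f i) = (\<Prod>j\<in>UNIV. f (Inl j)) * (\<Prod>k\<in>UNIV. f (Inr k))"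
  for f :: "'d::finite + 'v::finite \<Rightarrow> 'c::comm_monoid_mult"
  unfolding UNIV_Plus_UNIV[symmetric] by (subst prod.Plus) simp_all

lemma sum_over_sum_type:
  "(\<Sum>i\<in>(UNIV :: ('d::finite + 'v::finite) set). f i) = (\<Sum>j\<in>UNIV. f (Inl j)) + (\<Sum>k\<in>UNIV. f (Inr k))"
  for f :: "'d::finite + 'v::finite \<Rightarrow> 'c::comm_monoid_add"
  unfolding UNIV_Plus_UNIV[symmetric] by (subst sum.Plus) simp_all

lemma mono_val_expo: "mono_val (joint w y) (expo s q) = mpow w s * mpow y q"
  by (simp add: mono_val_def lookup_expo prod_over_sum_type mpow_def joint_def)

lemma mono_deg_expo: "mono_deg (expo s q) = mabs s + mabs q"
  by (simp add: mono_deg_def lookup_expo sum_over_sum_type mabs_def)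

text \<open>Through this bijection the sums over pairs of multi-indices in the expansion become sums over the
  monomials of the formal polynomials.\<close>

lemma bij_expo: "bij (\<lambda>(s, q). expo s q :: 'd::finite + 'v::finite \<Rightarrow>\<^sub>0 nat)"
proof (rule bijI)
  show "inj (\<lambda>(s, q). expo s q :: 'd + 'v \<Rightarrow>\<^sub>0 nat)"
  proof (rule injI, clarsimp)
    fix s s' :: "'d mindex" and q q' :: "'v mindex"
    assume "expo s q = expo s' q'"
    then have *: "case_sum s q = case_sum s' q'"
      by (metis lookup_expo)
    show "s = s' \<and> q = q'"
      using fun_cong[OF *, of "Inl _"] fun_cong[OF *, of "Inr _"] by (auto simp: fun_eq_iff)
  qed
  have "m = expo (\<lambda>j. Poly_Mapping.lookup m (Inl j)) (\<lambda>k. Poly_Mapping.lookup m (Inr k))"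
    for m :: "'d + 'v \<Rightarrow>\<^sub>0 nat"
    by (rule poly_mapping_eqI) (auto simp: lookup_expo split: sum.split)
  then show "surj (\<lambda>(s, q). expo s q :: 'd + 'v \<Rightarrow>\<^sub>0 nat)"
    by (metis case_prod_conv surj_def)
qed

lemma mpow_zero_index [simp]: "mpow a (\<lambda>_. 0) = 1"
  by (simp add: mpow_def)

lemma mabs_zero_index [simp]: "mabs (\<lambda>_. 0) = 0"
  by (simp add: mabs_def)

lemma mfact_zero_index [simp]: "mfact (\<lambda>_. 0) = 1"
  by (simp add: mfact_def)

lemma mabs_eq_0_iff: "mabs q = 0 \<longleftrightarrow> q = (\<lambda>_. 0)"
  by (auto simp: mabs_def)

lemma mpow_munit [simp]: "mpow a (munit k) = a $ k"
  by (simp add: mpow_def munit_def of_bool_def if_distrib cong: if_cong)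

lemma mabs_munit [simp]: "mabs (munit k) = 1"
  by (simp add: mabs_def munit_def of_bool_def)

lemma mpow_nonneg: "(\<And>k. 0 \<le> a $ k) \<Longrightarrow> 0 \<le> mpow a q"
  by (simp add: mpow_def prod_nonneg)

lemma mixed_partial_zero_index [simp]: "mixed_partial (\<lambda>_. 0) f = f"
proof -
  have "(SOME ks :: 'a list. \<forall>k. count_list ks k = 0) = []"
    by (rule some_equality) (auto simp: count_list_0_iff intro: ccontr)
  then show ?thesis by (simp add: mixed_partial_def)
qed

text \<open>Unconditional convergence over all multi-indices is used only along the exhaustion by total
  degree.  The two variants that follow fit the index sets of the drift part and of the diffusion
  part of \<open>noise_poly\<close>.\<close>

lemma sum_mabs_le_tendsto:
  fixes f :: "'v::finite mindex \<Rightarrow> real"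
  assumes "(f has_sum l) UNIV"
  shows "(\<lambda>N. \<Sum>q | mabs q \<le> N. f q) \<longlonglongrightarrow> l"
proof -
  have "filterlim (\<lambda>N. {q :: 'v mindex. mabs q \<le> N}) (finite_subsets_at_top UNIV) sequentially"
    unfolding filterlim_finite_subsets_at_top
  proof safe
    fix X :: "'v mindex set" assume "finite X"
    then obtain n where "mabs ` X \<subseteq> {..n}"
      using finite_nat_set_iff_bounded_le[of "mabs ` X"] by auto
    then show "\<forall>\<^sub>F N in sequentially. finite {q :: 'v mindex. mabs q \<le> N} \<and>
        X \<subseteq> {q. mabs q \<le> N} \<and> {q. mabs q \<le> N} \<subseteq> UNIV"
      by (intro eventually_sequentiallyI[of n]) (force simp: finite_mabs_le)
  qed
  then show ?thesis
    using assms unfolding has_sum_def by (rule filterlim_compose[rotated])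
qed

lemma sum_mabs_ge_1_tendsto:
  fixes f :: "'v::finite mindex \<Rightarrow> real"
  assumes "(f has_sum l) UNIV"
  shows "(\<lambda>N. \<Sum>q | 1 \<le> mabs q \<and> mabs q \<le> N. f q) \<longlonglongrightarrow> l - f (\<lambda>_. 0)"
proof -
  have "(\<Sum>q | 1 \<le> mabs q \<and> mabs q \<le> N. f q) = (\<Sum>q | mabs q \<le> N. f q) - f (\<lambda>_. 0)" for N
  proof -
    have "{q :: 'v mindex. 1 \<le> mabs q \<and> mabs q \<le> N} = {q. mabs q \<le> N} - {\<lambda>_. 0}"
      by (auto simp: mabs_eq_0_iff Suc_le_eq dest: gr0I)
    then show ?thesis
      by (simp only: sum_diff1[OF finite_mabs_le]) simp
  qed
  then show ?thesis
    by (auto intro!: tendsto_intros sum_mabs_le_tendsto assms)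
qed

lemma sum_mabs_le_pred_tendsto:
  fixes f :: "'v::finite mindex \<Rightarrow> real"
  assumes "(f has_sum l) UNIV"
  shows "(\<lambda>N. \<Sum>q | mabs q \<le> N - 1. f q) \<longlonglongrightarrow> l"
  by (rule filterlim_compose[OF sum_mabs_le_tendsto[OF assms] filterlim_minus_const_nat_at_top])

lemma summable_on_sum:
  fixes f :: "'a \<Rightarrow> 'b \<Rightarrow> real"
  assumes "\<And>i. i \<in> I \<Longrightarrow> f i summable_on A"
  shows "(\<lambda>x. \<Sum>i\<in>I. f i x) summable_on A"
  using assms by (induction I rule: infinite_finite_induct) (auto intro: summable_on_add)

lemma taylor_abs_summable:
  assumes "taylor_converges_on_box f x \<rho>" and \<rho>: "\<And>k. 0 \<le> \<rho> $ k"
  shows "(\<lambda>q. \<bar>mixed_partial q f x / mfact q\<bar> * mpow \<rho> q) summable_on UNIV"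
proof -
  have "(\<lambda>q. mixed_partial q f x / mfact q * mpow \<rho> q) summable_on UNIV"
    using assms by (intro has_sum_imp_summable[where S = "f (x + \<rho>)"]) (simp add: taylor_converges_on_box_def)
  then have "(\<lambda>q. norm (mixed_partial q f x / mfact q * mpow \<rho> q)) summable_on UNIV"
    by (rule iffD1[OF summable_on_iff_abs_summable_on_real])
  moreover have "norm (mixed_partial q f x / mfact q * mpow \<rho> q)
      = \<bar>mixed_partial q f x / mfact q\<bar> * mpow \<rho> q" for q
    using mpow_nonneg[OF \<rho>, of q] by (simp add: abs_mult)
  ultimately show ?thesis by (simp only:)
qed

lemma finite_mabs_ge_1: "finite {q :: 'v::finite mindex. 1 \<le> mabs q \<and> mabs q \<le> N}"
  by (rule finite_subset[OF _ finite_mabs_le[of N]]) auto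

lemma poly_val_noise_poly:
  "poly_val (joint w y) (noise_poly u G h N x t k) =
     y $ k
     + (\<Sum>q | 1 \<le> mabs q \<and> mabs q \<le> N. h * (mixed_partial q (\<lambda>z. u z t $ k) x / mfact q * mpow y q))
     + (\<Sum>j\<in>UNIV. \<Sum>q | mabs q \<le> N - 1.
          mixed_partial q (\<lambda>z. G z t $ k $ j) x / mfact q * mpow y q * w $ j)"
proof -
  have "(\<Sum>j\<in>UNIV. \<Sum>q | mabs q \<le> N - 1.
          mixed_partial q (\<lambda>z. G z t $ k $ j) x / mfact q * mpow y q * w $ j) =
        (\<Sum>q | mabs q \<le> N - 1. \<Sum>j\<in>UNIV.
          mixed_partial q (\<lambda>z. G z t $ k $ j) x / mfact q * mpow y q * w $ j)"
    by (rule sum.swap)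
  then show ?thesis
    by (simp add: noise_poly_def poly_val_add poly_val_sum mono_val_expo mult_ac)
qed

text \<open>At \<open>N = 0\<close> the bound fails: the term \<open>y $ k\<close> and the diffusion terms of order \<open>0\<close> are
  still present and linear.\<close>

lemma deg_le_noise_poly:
  assumes "1 \<le> N"
  shows "deg_le N (noise_poly u G h N x t k)"
  unfolding noise_poly_def using assms
  by (intro deg_le_add deg_le_sum deg_le_single) (auto simp: mono_deg_expo)

lemma lookup_noise_poly_0:
  fixes x :: "real ^ 'v::finite" and G :: "real ^ 'v \<Rightarrow> real \<Rightarrow> real ^ 'd::finite ^ 'v"
  shows "Poly_Mapping.lookup (noise_poly u G h N x t k) 0 = 0"
proof -
  have "joint (0 :: real ^ 'd) (0 :: real ^ 'v) = (\<lambda>_. 0)"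
    by (auto simp: joint_def fun_eq_iff split: sum.split)
  moreover have zero: "mpow 0 q = 0" if "mabs q \<noteq> 0" for q :: "'v mindex"
  proof -
    obtain i where "q i \<noteq> 0" using \<open>mabs q \<noteq> 0\<close> mabs_eq_0_iff[of q] by auto
    then show ?thesis by (auto simp: mpow_def intro!: prod_zero)
  qed
  have "poly_val (joint (0 :: real ^ 'd) (0 :: real ^ 'v)) (noise_poly u G h N x t k) = 0"
    unfolding poly_val_noise_poly by (auto intro!: sum.neutral simp: zero)
  ultimately show ?thesis
    by (simp only: poly_val_origin)
qed

lemma noise_poly_tendsto:
  assumes u: "taylor_converges_on_box (\<lambda>z. u z t $ k) x \<rho>"
    and G: "\<And>j. taylor_converges_on_box (\<lambda>z. G z t $ k $ j) x \<rho>"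
    and y: "\<And>i. \<bar>y $ i\<bar> \<le> \<rho> $ i"
  shows "(\<lambda>N. poly_val (joint w y) (noise_poly u G h N x t k)) \<longlonglongrightarrow>
     y $ k + h * (u (x + y) t $ k - u x t $ k) + (\<Sum>j\<in>UNIV. G (x + y) t $ k $ j * w $ j)"
proof -
  have "((\<lambda>q. mixed_partial q (\<lambda>z. u z t $ k) x / mfact q * mpow y q) has_sum u (x + y) t $ k) UNIV"
    using u y by (simp add: taylor_converges_on_box_def)
  from sum_mabs_ge_1_tendsto[OF this]
  have "(\<lambda>N. \<Sum>q | 1 \<le> mabs q \<and> mabs q \<le> N. mixed_partial q (\<lambda>z. u z t $ k) x / mfact q * mpow y q)
      \<longlonglongrightarrow> u (x + y) t $ k - u x t $ k" by simp
  moreover have "(\<lambda>N. \<Sum>q | mabs q \<le> N - 1. mixed_partial q (\<lambda>z. G z t $ k $ j) x / mfact q * mpow y q)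
      \<longlonglongrightarrow> G (x + y) t $ k $ j" for j
    using G[of j] y by (intro sum_mabs_le_pred_tendsto) (simp add: taylor_converges_on_box_def)
  ultimately show ?thesis
    unfolding poly_val_noise_poly sum_distrib_left[symmetric] sum_distrib_right[symmetric]
    by (intro tendsto_intros)
qed

text \<open>The norm evaluates the absolute values of the terms at the corner \<open>(a, \<rho>)\<close>.  There the Taylor
  series converge unconditionally, hence absolutely, so these values have a finite sum over all
  degrees, and passing from degree \<open>N div R\<close> to degree \<open>N\<close> adds a vanishing part of it.\<close>

lemma noise_poly_cauchy:
  fixes x \<rho> :: "real ^ 'v::finite" and a :: "real ^ 'd::finite"
  assumes u: "taylor_converges_on_box (\<lambda>z. u z t $ k) x \<rho>"
    and G: "\<And>j. taylor_converges_on_box (\<lambda>z. G z t $ k $ j) x \<rho>"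
    and a: "\<And>j. 0 \<le> a $ j" and \<rho>: "\<And>i. 0 \<le> \<rho> $ i"
  shows "\<exists>C. \<forall>N. poly_norm (joint a \<rho>) (noise_poly u G h N x t k) \<le> C" (is ?bounded)
    and "1 \<le> R \<Longrightarrow> (\<lambda>N. poly_norm (joint a \<rho>)
           (noise_poly u G h N x t k - noise_poly u G h (N div R) x t k)) \<longlonglongrightarrow> 0" (is "_ \<Longrightarrow> ?cauchy")
proof -
  define p where "p N = noise_poly u G h N x t k" for N
  define T1 where "T1 N = {q :: 'v mindex. 1 \<le> mabs q \<and> mabs q \<le> N}" for N
  define T2 where "T2 N = {q :: 'v mindex. mabs q \<le> N - 1}" for N
  define U where "U q = Poly_Mapping.single (expo (\<lambda>_::'d. 0) q)
            (h * (mixed_partial q (\<lambda>z. u z t $ k) x / mfact q))" for q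
  define V where "V q = (\<Sum>j\<in>UNIV. Poly_Mapping.single (expo (munit j) q)
            (mixed_partial q (\<lambda>z. G z t $ k $ j) x / mfact q))" for q
  define \<alpha> where "\<alpha> q = \<bar>h\<bar> * (\<bar>mixed_partial q (\<lambda>z. u z t $ k) x / mfact q\<bar> * mpow \<rho> q)" for q
  define \<beta> where "\<beta> q = (\<Sum>j\<in>UNIV. a $ j * (\<bar>mixed_partial q (\<lambda>z. G z t $ k $ j) x / mfact q\<bar> * mpow \<rho> q))" for q
  let ?norm = "poly_norm (joint a \<rho>)"
  have b: "0 \<le> joint a \<rho> i" for i
    using a \<rho> by (simp add: joint_def split: sum.split)
  have p: "p N = Poly_Mapping.single (expo (\<lambda>_. 0) (munit k)) 1 + sum U (T1 N) + sum V (T2 N)" for N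
    by (simp add: p_def noise_poly_def T1_def T2_def U_def V_def)
  have fin: "finite (T1 N)" "finite (T2 N)" for N
    unfolding T1_def T2_def by (rule finite_mabs_ge_1 finite_mabs_le)+
  have normU: "?norm (U q) \<le> \<alpha> q" for q
    by (simp add: U_def \<alpha>_def mono_val_expo abs_mult)
  have normV: "?norm (V q) \<le> \<beta> q" for q
    unfolding V_def \<beta>_def
    by (rule order_trans[OF poly_norm_sum[OF b]]) (simp add: mono_val_expo mult_ac)
  have le: "?norm (sum U S) \<le> sum \<alpha> S" "?norm (sum V S) \<le> sum \<beta> S" for S
    by (rule order_trans[OF poly_norm_sum[OF b] sum_mono], rule normU normV)+
  have "\<alpha> summable_on UNIV" "\<beta> summable_on UNIV"
    unfolding \<alpha>_def \<beta>_def
    by (intro summable_on_cmult_right summable_on_sum taylor_abs_summable u G \<rho>)+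
  then obtain l1 l2 where has: "(\<alpha> has_sum l1) UNIV" "(\<beta> has_sum l2) UNIV"
    by (auto simp: summable_on_def)
  have lim1: "(\<lambda>N. sum \<alpha> (T1 N)) \<longlonglongrightarrow> l1 - \<alpha> (\<lambda>_. 0)"
    unfolding T1_def by (rule sum_mabs_ge_1_tendsto[OF has(1)])
  have lim2: "(\<lambda>N. sum \<beta> (T2 N)) \<longlonglongrightarrow> l2"
    unfolding T2_def by (rule sum_mabs_le_pred_tendsto[OF has(2)])
  show ?bounded
  proof -
    have "?norm (p N) \<le> \<rho> $ k + sum \<alpha> (T1 N) + sum \<beta> (T2 N)" for N
    proof -
      have "?norm (p N) \<le> ?norm (Poly_Mapping.single (expo (\<lambda>_. 0) (munit k)) 1)
          + ?norm (sum U (T1 N)) + ?norm (sum V (T2 N))"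
        unfolding p by (rule order_trans[OF poly_norm_add[OF b] add_right_mono[OF poly_norm_add[OF b]]])
      then show ?thesis
        using le[of "T1 N"] le[of "T2 N"] by (simp add: mono_val_expo)
    qed
    moreover have "Bseq (\<lambda>N. \<rho> $ k + sum \<alpha> (T1 N) + sum \<beta> (T2 N))"
      by (rule convergent_imp_Bseq[OF convergentI[OF tendsto_add[OF tendsto_add[OF tendsto_const lim1] lim2]]])
    ultimately show ?thesis
      unfolding p_def[symmetric] Bseq_def by (metis abs_le_D1 order_trans real_norm_def)
  qed
  show ?cauchy if "1 \<le> R"
  proof -
    let ?A = "\<lambda>N. sum \<alpha> (T1 N)" and ?B = "\<lambda>N. sum \<beta> (T2 N)"
    have div: "filterlim (\<lambda>N. N div R) sequentially sequentially"
      using that by (intro filterlim_at_top_div_const_nat) simp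
    have le_diff: "?norm (p N - p (N div R)) \<le> (?A N - ?A (N div R)) + (?B N - ?B (N div R))" for N
    proof -
      let ?K = "N div R"
      have sub: "T1 ?K \<subseteq> T1 N" "T2 ?K \<subseteq> T2 N"
        using div_le_dividend[of N R] by (auto simp: T1_def T2_def simp del: div_le_dividend)
      have "p N - p ?K = sum U (T1 N - T1 ?K) + sum V (T2 N - T2 ?K)"
        using sub fin by (simp add: p sum_diff)
      then have "?norm (p N - p ?K) \<le> sum \<alpha> (T1 N - T1 ?K) + sum \<beta> (T2 N - T2 ?K)"
        by (simp only: order_trans[OF poly_norm_add[OF b] add_mono[OF le]])
      then show ?thesis
        using sub fin by (simp add: sum_diff)
    qed
    have lim_diff: "(\<lambda>N. (?A N - ?A (N div R)) + (?B N - ?B (N div R))) \<longlonglongrightarrow> 0"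
      using tendsto_add[OF tendsto_diff[OF lim1 filterlim_compose[OF lim1 div]]
          tendsto_diff[OF lim2 filterlim_compose[OF lim2 div]]] by simp
    show ?thesis
      unfolding p_def[symmetric]
      by (rule tendsto_sandwich[OF always_eventually always_eventually tendsto_const lim_diff])
         (use le_diff poly_norm_nonneg[OF b] in auto)
  qed
qed

lemma truncated_expansion_eq:
  fixes r :: "'v::finite mindex" and w :: "real ^ 'd::finite"
  shows "(\<Sum>(s, r') | 1 \<le> mabs s + mabs r' \<and> mabs s + mabs r' \<le> N.
          noise_coeff u G h N r s r' x t * mpow w s * mpow y r') =
     (\<Sum>m | 1 \<le> mono_deg m \<and> mono_deg m \<le> N.
          Poly_Mapping.lookup (\<Prod>k\<in>UNIV. noise_poly u G h N x t k ^ r k) m * mono_val (joint w y) m)"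
proof -
  let ?I = "{(s :: 'd mindex, r' :: 'v mindex). 1 \<le> mabs s + mabs r' \<and> mabs s + mabs r' \<le> N}"
  let ?J = "{m :: 'd + 'v \<Rightarrow>\<^sub>0 nat. 1 \<le> mono_deg m \<and> mono_deg m \<le> N}"
  have "(\<lambda>(s, q). expo s q) ` ?I = ?J"
  proof (intro equalityI subsetI)
    fix m :: "'d + 'v \<Rightarrow>\<^sub>0 nat" assume "m \<in> ?J"
    moreover obtain s q where "m = expo s q"
      using bij_is_surj[OF bij_expo] by (metis (mono_tags, lifting) case_prod_beta surj_def)
    ultimately show "m \<in> (\<lambda>(s, q). expo s q) ` ?I"
      by (auto simp: mono_deg_expo intro!: image_eqI[of _ _ "(s, q)"])
  qed (auto simp: mono_deg_expo)
  then have "bij_betw (\<lambda>(s, q). expo s q) ?I ?J"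
    by (rule bij_betw_subset[OF bij_expo subset_UNIV])
  then show ?thesis
    by (subst sum.reindex_bij_betw[symmetric, of _ ?I ?J])
       (auto intro!: sum.cong simp: mono_val_expo noise_coeff_def)
qed

text \<open>Truncation of the product loses nothing at the constant term: each factor vanishes at the
  origin and at least one factor is present since \<open>|r| \<ge> 1\<close>.\<close>

lemma truncated_expansion_error:
  fixes r :: "'v::finite mindex" and w :: "real ^ 'd::finite"
  assumes r: "1 \<le> mabs r"
    and w: "\<And>j. \<bar>w $ j\<bar> \<le> a $ j" and y: "\<And>k. \<bar>y $ k\<bar> \<le> \<rho> $ k"
  shows "\<bar>poly_val (joint w y) (\<Prod>k\<in>UNIV. noise_poly u G h N x t k ^ r k)
      - (\<Sum>(s, r') | 1 \<le> mabs s + mabs r' \<and> mabs s + mabs r' \<le> N.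
          noise_coeff u G h N r s r' x t * mpow w s * mpow y r')\<bar>
    \<le> poly_tail (joint a \<rho>) N (\<Prod>k\<in>UNIV. noise_poly u G h N x t k ^ r k)"
  unfolding truncated_expansion_eq
proof (rule abs_poly_val_minus_truncation_le)
  have "0 \<le> joint a \<rho> i" for i
    using order_trans[OF abs_ge_zero w] order_trans[OF abs_ge_zero y]
    by (simp add: joint_def split: sum.split)
  then show "0 \<le> joint a \<rho> i" for i .
  show "\<bar>joint w y i\<bar> \<le> joint a \<rho> i" for i
    using w y by (simp add: joint_def split: sum.split)
  obtain k where "r k \<noteq> 0"
    using r mabs_eq_0_iff[of r] by auto
  moreover have "poly_val (\<lambda>_. 0) (noise_poly u G h N x t k) = 0" for k
    by (simp only: poly_val_origin lookup_noise_poly_0)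
  ultimately have "poly_val (\<lambda>_. 0) (\<Prod>k\<in>UNIV. noise_poly u G h N x t k ^ r k) = 0"
    by (simp add: poly_val_prod poly_val_power) (auto intro!: exI[of _ k])
  then show "Poly_Mapping.lookup (\<Prod>k\<in>UNIV. noise_poly u G h N x t k ^ r k) 0 = 0"
    by (simp only: poly_val_origin)
qed

section \<open>Convergence of the truncated expansion\<close>

text \<open>The remainder of the expansion depends on the randomness only through the increment \<open>w\<close> and the
  previous effective noise \<open>y\<close>.  As a function of \<open>w\<close> and \<open>y\<close> it can be bounded uniformly on a box.\<close>

definition noise_step ::
    "(real ^ 'v::finite \<Rightarrow> real \<Rightarrow> real ^ 'v) \<Rightarrow> (real ^ 'v \<Rightarrow> real \<Rightarrow> real ^ 'd::finite ^ 'v) \<Rightarrow>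
     real \<Rightarrow> real ^ 'v \<Rightarrow> real \<Rightarrow> real ^ 'd \<Rightarrow> real ^ 'v \<Rightarrow> real ^ 'v" where
  "noise_step u G h x t w y = (\<chi> k. y $ k + h * (u (x + y) t $ k - u x t $ k)
      + (\<Sum>j\<in>UNIV. G (x + y) t $ k $ j * w $ j))"

definition trunc_error ::
    "(real ^ 'v::finite \<Rightarrow> real \<Rightarrow> real ^ 'v) \<Rightarrow> (real ^ 'v \<Rightarrow> real \<Rightarrow> real ^ 'd::finite ^ 'v) \<Rightarrow>
     real \<Rightarrow> nat \<Rightarrow> 'v mindex \<Rightarrow> real ^ 'v \<Rightarrow> real \<Rightarrow> real ^ 'd \<Rightarrow> real ^ 'v \<Rightarrow> real" where
  "trunc_error u G h N r x t w y = mpow (noise_step u G h x t w y) r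
      - (\<Sum>(s, r') | 1 \<le> mabs s + mabs r' \<and> mabs s + mabs r' \<le> N.
          noise_coeff u G h N r s r' x t * mpow w s * mpow y r')"

text \<open>The error splits into the distance of \<open>mpow (noise_step \<dots>) r\<close> from the full product of the
  approximants and the tail of that product beyond degree \<open>N\<close>.  Both tend to \<open>0\<close>, and the product of
  the norm bounds \<open>C k\<close> controls the former uniformly.\<close>

lemma truncated_expansion_converges:
  fixes r :: "'v::finite mindex" and a :: "real ^ 'd::finite" and x \<rho> :: "real ^ 'v"
    and u :: "real ^ 'v \<Rightarrow> real \<Rightarrow> real ^ 'v" and G :: "real ^ 'v \<Rightarrow> real \<Rightarrow> real ^ 'd ^ 'v"
    and t h :: real
  assumes r: "1 \<le> mabs r"
    and u: "\<And>k. taylor_converges_on_box (\<lambda>z. u z t $ k) x \<rho>"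
    and G: "\<And>k j. taylor_converges_on_box (\<lambda>z. G z t $ k $ j) x \<rho>"
    and a: "\<And>j. 0 \<le> a $ j" and \<rho>: "\<And>k. 0 \<le> \<rho> $ k"
  shows "\<exists>D. \<forall>N w y. (\<forall>j. \<bar>w $ j\<bar> \<le> a $ j) \<longrightarrow> (\<forall>k. \<bar>y $ k\<bar> \<le> \<rho> $ k) \<longrightarrow> \<bar>trunc_error u G h N r x t w y\<bar> \<le> D"
    and "\<forall>j. \<bar>w $ j\<bar> \<le> a $ j \<Longrightarrow> \<forall>k. \<bar>y $ k\<bar> \<le> \<rho> $ k \<Longrightarrow> (\<lambda>N. trunc_error u G h N r x t w y) \<longlonglongrightarrow> 0"
proof -
  define p where "p k N = noise_poly u G h N x t k" for k N
  define P where "P N = (\<Prod>k\<in>UNIV. p k N ^ r k)" for N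
  let ?F = "noise_step u G h x t"
  let ?norm = "poly_norm (joint a \<rho>)"
  have b: "0 \<le> joint a \<rho> i" for i
    using a \<rho> by (simp add: joint_def split: sum.split)
  have "\<exists>C. \<forall>N. ?norm (p k N) \<le> C" for k
    unfolding p_def by (rule noise_poly_cauchy(1)) (rule u G a \<rho>)+
  then obtain C where C: "?norm (p k N) \<le> C k" for k N
    by metis
  have tail: "(\<lambda>N. poly_tail (joint a \<rho>) N (P N)) \<longlonglongrightarrow> 0"
    unfolding P_def
  proof (rule poly_tail_prod_tendsto_0[OF b _ C])
    show "1 \<le> (\<Sum>k\<in>UNIV. r k)"
      using r by (simp add: mabs_def)
    then show "(\<lambda>N. ?norm (p k N - p k (N div (\<Sum>k\<in>UNIV. r k)))) \<longlonglongrightarrow> 0" for k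
      unfolding p_def by (rule noise_poly_cauchy(2)[rotated -1]) (rule u G a \<rho>)+
    show "1 \<le> N \<Longrightarrow> deg_le N (p k N)" for k N
      unfolding p_def by (rule deg_le_noise_poly)
  qed
  then obtain T where T: "poly_tail (joint a \<rho>) N (P N) \<le> T" for N
    using convergent_imp_Bseq[OF convergentI[OF tail]]
    unfolding Bseq_def by (metis abs_le_D1 real_norm_def)
  {
    fix w :: "real ^ 'd" and y :: "real ^ 'v"
    assume wy: "\<forall>j. \<bar>w $ j\<bar> \<le> a $ j" "\<forall>k. \<bar>y $ k\<bar> \<le> \<rho> $ k"
    have lim: "(\<lambda>N. poly_val (joint w y) (p k N)) \<longlonglongrightarrow> ?F w y $ k" for k
      unfolding p_def noise_step_def vec_lambda_beta by (rule noise_poly_tendsto) (use wy u G in auto)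
    have le: "\<bar>poly_val (joint w y) (p k N)\<bar> \<le> C k" for k N
      by (rule order_trans[OF abs_poly_val_le[OF b] C])
         (use wy in \<open>simp add: joint_def split: sum.split\<close>)
    have "\<bar>?F w y $ k\<bar> \<le> C k" for k
      by (rule tendsto_upperbound[OF tendsto_rabs[OF lim]]) (auto simp: le)
    then have F_le: "\<bar>mpow (?F w y) r\<bar> \<le> (\<Prod>k\<in>UNIV. C k ^ r k)"
      unfolding mpow_def abs_prod power_abs by (intro prod_mono conjI power_mono) auto
    have val_le: "\<bar>poly_val (joint w y) (P N)\<bar> \<le> (\<Prod>k\<in>UNIV. C k ^ r k)" for N
      unfolding P_def poly_val_prod poly_val_power abs_prod power_abs
      using le by (intro prod_mono conjI power_mono) auto
    have "(\<lambda>N. poly_val (joint w y) (P N)) \<longlonglongrightarrow> mpow (?F w y) r"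
      unfolding P_def poly_val_prod poly_val_power mpow_def by (intro tendsto_intros lim)
    from tendsto_diff[OF tendsto_const[of "mpow (?F w y) r"] this]
    have val_lim: "(\<lambda>N. mpow (?F w y) r - poly_val (joint w y) (P N)) \<longlonglongrightarrow> 0"
      by simp
    have Rem_le: "\<bar>trunc_error u G h N r x t w y\<bar>
        \<le> \<bar>mpow (?F w y) r - poly_val (joint w y) (P N)\<bar> + poly_tail (joint a \<rho>) N (P N)" for N
      using truncated_expansion_error[OF r, of w a y \<rho> u G h N x t] wy
      unfolding trunc_error_def P_def p_def by (simp del: One_nat_def)
    show "(\<lambda>N. trunc_error u G h N r x t w y) \<longlonglongrightarrow> 0"
      by (rule Lim_null_comparison[OF always_eventually tendsto_add_zero[OF tendsto_rabs_zero[OF val_lim] tail]])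
         (use Rem_le in auto)
    have "\<bar>trunc_error u G h N r x t w y\<bar> \<le> 2 * (\<Prod>k\<in>UNIV. C k ^ r k) + T" for N
      using Rem_le[of N] F_le val_le[of N] T[of N] by linarith
  }
  then show "\<exists>D. \<forall>N w y. (\<forall>j. \<bar>w $ j\<bar> \<le> a $ j) \<longrightarrow> (\<forall>k. \<bar>y $ k\<bar> \<le> \<rho> $ k) \<longrightarrow> \<bar>trunc_error u G h N r x t w y\<bar> \<le> D"
    by blast
qed

section \<open>The Euler--Maruyama sequence as a functional of the noise increments\<close>

text \<open>The same recursion as \<open>euler_maruyama\<close>, driven by a deterministic sequence \<open>\<xi>\<close>, where \<open>\<xi> i\<close>
  stands for the increment of step \<open>i + 1\<close>.  It exhibits the state after \<open>n\<close> steps as a function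
  of the first \<open>n\<close> increments.\<close>

primrec euler_path ::
    "(real ^ 'v::finite \<Rightarrow> real \<Rightarrow> real ^ 'v) \<Rightarrow> (real ^ 'v \<Rightarrow> real \<Rightarrow> real ^ 'd::finite ^ 'v) \<Rightarrow>
     real \<Rightarrow> real \<Rightarrow> real ^ 'v \<Rightarrow> nat \<Rightarrow> (nat \<Rightarrow> real ^ 'd) \<Rightarrow> real ^ 'v" where
  "euler_path u G t0 h x0 0 \<xi> = x0"
| "euler_path u G t0 h x0 (Suc n) \<xi> =
     euler_path u G t0 h x0 n \<xi>
     + h *\<^sub>R u (euler_path u G t0 h x0 n \<xi>) (grid t0 h n)
     + G (euler_path u G t0 h x0 n \<xi>) (grid t0 h n) *v \<xi> n"

lemma euler_maruyama_eq_path: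
  assumes "{..<n} \<subseteq> I"
  shows "euler_maruyama u G W t0 h x0 n \<omega> =
    euler_path u G t0 h x0 n (restrict (\<lambda>i. noise_incr W t0 h (Suc i) \<omega>) I)"
  using assms by (induction n) (auto simp: subset_eq)

lemma smooth_fun_imp_continuous: "smooth_fun f \<Longrightarrow> continuous_on UNIV f"
  by (auto simp: smooth_fun_def dest: spec[of _ "[]"])

lemma euler_path_measurable:
  fixes u :: "real ^ 'v::finite \<Rightarrow> real \<Rightarrow> real ^ 'v"
    and G :: "real ^ 'v \<Rightarrow> real \<Rightarrow> real ^ 'd::finite ^ 'v"
  assumes u: "\<And>i k. continuous_on UNIV (\<lambda>x. u x (grid t0 h i) $ k)"
    and G: "\<And>i k j. continuous_on UNIV (\<lambda>x. G x (grid t0 h i) $ k $ j)"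
    and "{..<n} \<subseteq> I"
  shows "euler_path u G t0 h x0 n \<in> borel_measurable (Pi\<^sub>M I (\<lambda>_. borel))"
  using assms(3)
proof (induction n)
  case 0
  have "euler_path u G t0 h x0 0 = (\<lambda>_. x0)"
    by (simp add: fun_eq_iff)
  then show ?case by simp
next
  case (Suc n)
  let ?step = "\<lambda>(x :: real ^ 'v) w. x + h *\<^sub>R u x (grid t0 h n) + G x (grid t0 h n) *v w"
  have "continuous_on UNIV (\<lambda>z. \<chi> k. fst z $ k + h * u (fst z) (grid t0 h n) $ k
      + (\<Sum>j\<in>UNIV. G (fst z) (grid t0 h n) $ k $ j * snd z $ j))"
    by (intro continuous_on_vec_lambda continuous_intros
          continuous_on_compose2[OF u] continuous_on_compose2[OF G]) auto
  also have "(\<lambda>z. \<chi> k. fst z $ k + h * u (fst z) (grid t0 h n) $ k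
      + (\<Sum>j\<in>UNIV. G (fst z) (grid t0 h n) $ k $ j * snd z $ j)) = (\<lambda>z. ?step (fst z) (snd z))"
    by (simp add: fun_eq_iff vec_eq_iff matrix_vector_mult_def)
  finally have step: "continuous_on UNIV (\<lambda>z. ?step (fst z) (snd z))" .
  have "euler_path u G t0 h x0 n \<in> borel_measurable (Pi\<^sub>M I (\<lambda>_. borel))"
    using Suc.prems by (intro Suc.IH) (auto simp: subset_eq)
  moreover have "(\<lambda>\<xi>. \<xi> n) \<in> borel_measurable (Pi\<^sub>M I (\<lambda>_. borel))"
    using Suc.prems by (intro measurable_component_singleton) auto
  ultimately show ?case
    using borel_measurable_continuous_Pair[OF _ _ step] by auto
qed

lemma mpow_measurable: "(\<lambda>a :: real ^ 'v::finite. mpow a q) \<in> borel_measurable borel"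
  unfolding mpow_def
  by (intro borel_measurable_continuous_onI continuous_intros)

lemma eff_noise_step:
  assumes "1 \<le> n"
  shows "eff_noise u G W t0 h x0 n \<omega> =
    noise_step u G h (central_part u t0 h x0 (n - 1)) (grid t0 h (n - 1))
      (noise_incr W t0 h n \<omega>) (eff_noise u G W t0 h x0 (n - 1) \<omega>)"
proof -
  obtain n' where "n = Suc n'"
    using assms by (cases n) auto
  then show ?thesis
    by (simp add: eff_noise_def noise_step_def vec_eq_iff matrix_vector_mult_def algebra_simps)
qed

lemma noise_remainder_eq_trunc_error:
  assumes "1 \<le> n"
  shows "noise_remainder u G W t0 h x0 r n N \<omega> =
    trunc_error u G h N r (central_part u t0 h x0 (n - 1)) (grid t0 h (n - 1))
      (noise_incr W t0 h n \<omega>) (eff_noise u G W t0 h x0 (n - 1) \<omega>)"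
  unfolding noise_remainder_def trunc_error_def eff_noise_step[OF assms] ..

text \<open>The previous effective noise is a functional of the increments before step \<open>n\<close>, and hence
  independent of the increment of step \<open>n\<close>.\<close>

lemma indep_noise_incr_eff_noise:
  fixes W :: "real \<Rightarrow> 'a \<Rightarrow> real ^ 'd::finite" and u :: "real ^ 'v::finite \<Rightarrow> real \<Rightarrow> real ^ 'v"
  assumes "prob_space M" "independent_increments M W" "0 < h" "0 \<le> t0" "1 \<le> n"
    and u: "\<And>i k. continuous_on UNIV (\<lambda>x. u x (grid t0 h i) $ k)"
    and G: "\<And>i k j. continuous_on UNIV (\<lambda>x. G x (grid t0 h i) $ k $ j)"
  shows "prob_space.indep_var M borel (\<lambda>\<omega>. mpow (noise_incr W t0 h n \<omega>) s)
    borel (\<lambda>\<omega>. mpow (eff_noise u G W t0 h x0 (n - 1) \<omega>) q)"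
proof -
  interpret prob_space M by fact
  let ?X = "\<lambda>i \<omega>. noise_incr W t0 h (Suc i) \<omega>"
  have "\<And>i. grid t0 h i < grid t0 h (Suc i)" "0 \<le> grid t0 h 0"
    using assms by (auto simp: grid_def)
  then have "indep_vars (\<lambda>_. borel) ?X {..<n}"
    using assms(2) unfolding independent_increments_def noise_incr_def by simp
  then have "indep_var (Pi\<^sub>M {n - 1} (\<lambda>_. borel)) (\<lambda>\<omega>. restrict (\<lambda>i. ?X i \<omega>) {n - 1})
      (Pi\<^sub>M {..<n - 1} (\<lambda>_. borel)) (\<lambda>\<omega>. restrict (\<lambda>i. ?X i \<omega>) {..<n - 1})"
    by (rule indep_var_restrict) (use assms in auto)
  moreover have "(\<lambda>\<xi>. \<xi> (n - 1)) \<in> borel_measurable (Pi\<^sub>M {n - 1} (\<lambda>_. borel :: (real ^ 'd) measure))"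
    by (rule measurable_component_singleton) simp
  note measurable_compose[OF this mpow_measurable[of s]]
  moreover have "euler_path u G t0 h x0 (n - 1) \<in> borel_measurable (Pi\<^sub>M {..<n - 1} (\<lambda>_. borel))"
    by (rule euler_path_measurable) (use u G in auto)
  then have "(\<lambda>\<xi>. mpow (euler_path u G t0 h x0 (n - 1) \<xi> - central_part u t0 h x0 (n - 1)) q)
      \<in> borel_measurable (Pi\<^sub>M {..<n - 1} (\<lambda>_. borel))"
    by (intro measurable_compose[OF _ mpow_measurable] borel_measurable_diff) auto
  ultimately have "indep_var
      borel ((\<lambda>\<xi>. mpow (\<xi> (n - 1)) s) \<circ> (\<lambda>\<omega>. restrict (\<lambda>i. ?X i \<omega>) {n - 1}))
      borel ((\<lambda>\<xi>. mpow (euler_path u G t0 h x0 (n - 1) \<xi> - central_part u t0 h x0 (n - 1)) q)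
        \<circ> (\<lambda>\<omega>. restrict (\<lambda>i. ?X i \<omega>) {..<n - 1}))"
    by (rule indep_var_compose)
  moreover have "euler_path u G t0 h x0 (n - 1) (restrict (\<lambda>i. ?X i \<omega>) {..<n - 1})
      = euler_maruyama u G W t0 h x0 (n - 1) \<omega>" for \<omega>
    by (rule euler_maruyama_eq_path[symmetric]) simp
  ultimately show ?thesis
    using assms(5) by (simp add: comp_def eff_noise_def)
qed

lemma noise_incr_measurable:
  assumes "\<And>t. 0 \<le> t \<Longrightarrow> W t \<in> borel_measurable M" and "0 < h" "0 \<le> t0"
  shows "noise_incr W t0 h n \<in> borel_measurable M"
  unfolding noise_incr_def using assms by (intro borel_measurable_diff) (auto simp: grid_def)

lemma eff_noise_measurable:
  assumes "\<And>t. 0 \<le> t \<Longrightarrow> W t \<in> borel_measurable M" and "0 < h" "0 \<le> t0"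
    and u: "\<And>i k. continuous_on UNIV (\<lambda>x. u x (grid t0 h i) $ k)"
    and G: "\<And>i k j. continuous_on UNIV (\<lambda>x. G x (grid t0 h i) $ k $ j)"
  shows "eff_noise u G W t0 h x0 n \<in> borel_measurable M"
proof -
  have path: "euler_path u G t0 h x0 n \<in> borel_measurable (Pi\<^sub>M {..<n} (\<lambda>_. borel))"
    by (rule euler_path_measurable) (use u G in auto)
  have "(\<lambda>\<omega>. restrict (\<lambda>i. noise_incr W t0 h (Suc i) \<omega>) {..<n}) \<in> measurable M (Pi\<^sub>M {..<n} (\<lambda>_. borel))"
    by (intro measurable_restrict noise_incr_measurable assms)
  from measurable_compose[OF this path]
  have "(\<lambda>\<omega>. euler_path u G t0 h x0 n (restrict (\<lambda>i. noise_incr W t0 h (Suc i) \<omega>) {..<n}))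
      \<in> borel_measurable M" .
  then show ?thesis
    unfolding eff_noise_def by (simp add: euler_maruyama_eq_path[of n "{..<n}"])
qed

section \<open>Expectations\<close>

lemma noise_remainder_measurable:
  fixes W :: "real \<Rightarrow> 'a \<Rightarrow> real ^ 'd::finite" and u :: "real ^ 'v::finite \<Rightarrow> real \<Rightarrow> real ^ 'v"
  assumes W: "\<And>t. 0 \<le> t \<Longrightarrow> W t \<in> borel_measurable M" and h: "0 < h" "0 \<le> t0"
    and u: "\<And>i k. continuous_on UNIV (\<lambda>x. u x (grid t0 h i) $ k)"
    and G: "\<And>i k j. continuous_on UNIV (\<lambda>x. G x (grid t0 h i) $ k $ j)"
  shows "noise_remainder u G W t0 h x0 r n N \<in> borel_measurable M"
proof -
  have "(\<lambda>\<omega>. mpow (noise_incr W t0 h n \<omega>) s) \<in> borel_measurable M" for s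
    by (rule measurable_compose[OF noise_incr_measurable mpow_measurable]) (fact W h)+
  moreover have "(\<lambda>\<omega>. mpow (eff_noise u G W t0 h x0 m \<omega>) q) \<in> borel_measurable M" for m q
    by (rule measurable_compose[OF eff_noise_measurable mpow_measurable]) (fact W h u G)+
  ultimately show ?thesis
    unfolding noise_remainder_def case_prod_beta'
    by (intro borel_measurable_diff borel_measurable_sum borel_measurable_times
          borel_measurable_const) auto
qed

text \<open>The coefficients are constants, so linearity and independence of the increment from the
  past give the identity.\<close>

lemma expectation_of_expansion:
  fixes W :: "real \<Rightarrow> 'a \<Rightarrow> real ^ 'd::finite" and u :: "real ^ 'v::finite \<Rightarrow> real \<Rightarrow> real ^ 'v"
  assumes M: "prob_space M"
    and indep: "\<And>s q. prob_space.indep_var M borel (\<lambda>\<omega>. mpow (noise_incr W t0 h n \<omega>) s)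
      borel (\<lambda>\<omega>. mpow (eff_noise u G W t0 h x0 (n - 1) \<omega>) q)"
    and int_r: "integrable M (\<lambda>\<omega>. mpow (eff_noise u G W t0 h x0 n \<omega>) r)"
    and int_s: "\<And>s. mabs s \<le> N \<Longrightarrow> integrable M (\<lambda>\<omega>. mpow (noise_incr W t0 h n \<omega>) s)"
    and int_q: "\<And>q. mabs q \<le> N \<Longrightarrow> integrable M (\<lambda>\<omega>. mpow (eff_noise u G W t0 h x0 (n - 1) \<omega>) q)"
  shows "integrable M (noise_remainder u G W t0 h x0 r n N)"
    and "(\<integral>\<omega>. mpow (eff_noise u G W t0 h x0 n \<omega>) r \<partial>M) =
          (\<Sum>(s, r') | 1 \<le> mabs s + mabs r' \<and> mabs s + mabs r' \<le> N.
             noise_coeff u G h N r s r' (central_part u t0 h x0 (n - 1)) (grid t0 h (n - 1))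
             * (\<integral>\<omega>. mpow (noise_incr W t0 h n \<omega>) s \<partial>M)
             * (\<integral>\<omega>. mpow (eff_noise u G W t0 h x0 (n - 1) \<omega>) r' \<partial>M))
          + (\<integral>\<omega>. noise_remainder u G W t0 h x0 r n N \<omega> \<partial>M)"
proof -
  interpret prob_space M by (rule M)
  let ?I = "{(s :: 'd mindex, r' :: 'v mindex). 1 \<le> mabs s + mabs r' \<and> mabs s + mabs r' \<le> N}"
  let ?c = "\<lambda>s r'. noise_coeff u G h N r s r' (central_part u t0 h x0 (n - 1)) (grid t0 h (n - 1))"
  let ?w = "\<lambda>s \<omega>. mpow (noise_incr W t0 h n \<omega>) s"
  let ?y = "\<lambda>q \<omega>. mpow (eff_noise u G W t0 h x0 (n - 1) \<omega>) q"
  let ?f = "\<lambda>(s, r') \<omega>. ?c s r' * ?w s \<omega> * ?y r' \<omega>"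
  have term_int: "integrable M (?f (s, q))"
    and term_eq: "(\<integral>\<omega>. ?f (s, q) \<omega> \<partial>M) = ?c s q * (\<integral>\<omega>. ?w s \<omega> \<partial>M) * (\<integral>\<omega>. ?y q \<omega> \<partial>M)"
    if "(s, q) \<in> ?I" for s q
  proof -
    from that have le: "mabs s \<le> N" "mabs q \<le> N" by auto
    show "integrable M (?f (s, q))"
      using indep_var_integrable[OF indep int_s int_q, OF le] by (simp add: mult.assoc)
    show "(\<integral>\<omega>. ?f (s, q) \<omega> \<partial>M) = ?c s q * (\<integral>\<omega>. ?w s \<omega> \<partial>M) * (\<integral>\<omega>. ?y q \<omega> \<partial>M)"
      using indep_var_lebesgue_integral[OF indep int_s int_q, OF le] by (simp add: mult.assoc)
  qed
  have ints: "integrable M (\<lambda>\<omega>. \<Sum>i\<in>?I. ?f i \<omega>)"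
    using term_int by (intro Bochner_Integration.integrable_sum) auto
  have Rem: "noise_remainder u G W t0 h x0 r n N =
      (\<lambda>\<omega>. mpow (eff_noise u G W t0 h x0 n \<omega>) r - (\<Sum>i\<in>?I. ?f i \<omega>))"
    by (simp add: fun_eq_iff noise_remainder_def case_prod_beta')
  show "integrable M (noise_remainder u G W t0 h x0 r n N)"
    unfolding Rem by (intro Bochner_Integration.integrable_diff int_r ints)
  have "(\<integral>\<omega>. (\<Sum>i\<in>?I. ?f i \<omega>) \<partial>M) = (\<Sum>i\<in>?I. \<integral>\<omega>. ?f i \<omega> \<partial>M)"
    using term_int by (intro Bochner_Integration.integral_sum) auto
  also have "\<dots> = (\<Sum>(s, r')\<in>?I. ?c s r' * (\<integral>\<omega>. ?w s \<omega> \<partial>M) * (\<integral>\<omega>. ?y r' \<omega> \<partial>M))"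
    using term_eq by (intro sum.cong) auto
  finally show "(\<integral>\<omega>. mpow (eff_noise u G W t0 h x0 n \<omega>) r \<partial>M) =
      (\<Sum>(s, r')\<in>?I. ?c s r' * (\<integral>\<omega>. ?w s \<omega> \<partial>M) * (\<integral>\<omega>. ?y r' \<omega> \<partial>M))
      + (\<integral>\<omega>. noise_remainder u G W t0 h x0 r n N \<omega> \<partial>M)"
    unfolding Rem Bochner_Integration.integral_diff[OF int_r ints] by simp
qed

text \<open>Almost surely the increment and the previous effective noise lie in a fixed box, on which the
  remainder is bounded uniformly in \<open>N\<close> and tends to \<open>0\<close>; dominated convergence does the rest.\<close>

lemma expectation_of_remainder_tendsto_0:
  fixes W :: "real \<Rightarrow> 'a \<Rightarrow> real ^ 'd::finite" and u :: "real ^ 'v::finite \<Rightarrow> real \<Rightarrow> real ^ 'v"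
  assumes M: "prob_space M" and n: "1 \<le> n" and r: "1 \<le> mabs r"
    and meas: "\<And>N. noise_remainder u G W t0 h x0 r n N \<in> borel_measurable M"
    and w: "\<And>j. AE \<omega> in M. \<bar>noise_incr W t0 h n \<omega> $ j\<bar> \<le> a $ j"
    and y: "\<And>k. AE \<omega> in M. \<bar>eff_noise u G W t0 h x0 (n - 1) \<omega> $ k\<bar> \<le> \<rho> $ k"
    and u: "\<And>k. taylor_converges_on_box (\<lambda>x. u x (grid t0 h (n - 1)) $ k)
               (central_part u t0 h x0 (n - 1)) \<rho>"
    and G: "\<And>k j. taylor_converges_on_box (\<lambda>x. G x (grid t0 h (n - 1)) $ k $ j)
               (central_part u t0 h x0 (n - 1)) \<rho>"
  shows "integrable M (noise_remainder u G W t0 h x0 r n N)"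
    and "(\<lambda>N. \<integral>\<omega>. noise_remainder u G W t0 h x0 r n N \<omega> \<partial>M) \<longlonglongrightarrow> 0"
proof -
  interpret prob_space M by (rule M)
  \<comment> \<open>A bound that holds almost surely holds for at least one outcome, as the space is not null.\<close>
  have nonneg: "0 \<le> b" if "AE \<omega> in M. \<bar>f \<omega>\<bar> \<le> b" for f and b :: real
  proof -
    have "AE \<omega> in M. 0 \<le> b"
      using that by eventually_elim (rule order_trans[OF abs_ge_zero])
    then show ?thesis by simp
  qed
  have a: "0 \<le> a $ j" and \<rho>: "0 \<le> \<rho> $ k" for j k
    by (rule nonneg[OF w], rule nonneg[OF y])
  have box: "AE \<omega> in M. (\<forall>j. \<bar>noise_incr W t0 h n \<omega> $ j\<bar> \<le> a $ j) \<and>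
      (\<forall>k. \<bar>eff_noise u G W t0 h x0 (n - 1) \<omega> $ k\<bar> \<le> \<rho> $ k)"
    using w y by (simp add: AE_all_countable)
  obtain D where D: "\<And>N. AE \<omega> in M. \<bar>noise_remainder u G W t0 h x0 r n N \<omega>\<bar> \<le> D"
  proof -
    have "\<exists>D. \<forall>N w y. (\<forall>j. \<bar>w $ j\<bar> \<le> a $ j) \<longrightarrow> (\<forall>k. \<bar>y $ k\<bar> \<le> \<rho> $ k) \<longrightarrow>
        \<bar>trunc_error u G h N r (central_part u t0 h x0 (n - 1)) (grid t0 h (n - 1)) w y\<bar> \<le> D"
      by (rule truncated_expansion_converges(1)) (rule r u G a \<rho>)+
    then obtain D where D: "\<bar>trunc_error u G h N r (central_part u t0 h x0 (n - 1)) (grid t0 h (n - 1)) w y\<bar> \<le> D"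
      if "\<forall>j. \<bar>w $ j\<bar> \<le> a $ j" "\<forall>k. \<bar>y $ k\<bar> \<le> \<rho> $ k" for N w y
      by blast
    have "AE \<omega> in M. \<bar>noise_remainder u G W t0 h x0 r n N \<omega>\<bar> \<le> D" for N
      using box
    proof eventually_elim
      case (elim \<omega>)
      then show ?case
        unfolding noise_remainder_eq_trunc_error[OF n] by (elim conjE) (rule D)
    qed
    then show ?thesis
      by (rule that)
  qed
  have lim: "AE \<omega> in M. (\<lambda>N. noise_remainder u G W t0 h x0 r n N \<omega>) \<longlonglongrightarrow> 0"
    using box
  proof eventually_elim
    case (elim \<omega>)
    show ?case
      unfolding noise_remainder_eq_trunc_error[OF n]
      by (rule truncated_expansion_converges(2)) (use r u G a \<rho> elim in auto)
  qed
  show "integrable M (noise_remainder u G W t0 h x0 r n N)" for N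
    by (rule integrable_const_bound[OF _ meas, of _ D]) (use D[of N] in simp)
  have "(\<lambda>N. \<integral>\<omega>. noise_remainder u G W t0 h x0 r n N \<omega> \<partial>M) \<longlonglongrightarrow> (\<integral>\<omega>. 0 \<partial>M)"
    by (rule integral_dominated_convergence[where w = "\<lambda>_. D"]) (use meas lim D in auto)
  then show "(\<lambda>N. \<integral>\<omega>. noise_remainder u G W t0 h x0 r n N \<omega> \<partial>M) \<longlonglongrightarrow> 0"
    by simp
qed

theorem theorem3p5:
  fixes M :: "'a measure"
    and W :: "real \<Rightarrow> 'a \<Rightarrow> real ^ 'd::finite"
    and u :: "real ^ 'v::finite \<Rightarrow> real \<Rightarrow> real ^ 'v"
    and G :: "real ^ 'v \<Rightarrow> real \<Rightarrow> real ^ 'd ^ 'v"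
    and t0 h :: real
    and x0 :: "real ^ 'v"
    and r :: "'v mindex"
    and n :: nat
  assumes "prob_space M"
    and "\<And>t. 0 \<le> t \<Longrightarrow> W t \<in> borel_measurable M"
    and "independent_increments M W"
    and "0 < h" and "0 \<le> t0"
    and "\<And>t k. 0 \<le> t \<Longrightarrow> smooth_fun (\<lambda>x. u x t $ k)"
    and "\<And>t k j. 0 \<le> t \<Longrightarrow> smooth_fun (\<lambda>x. G x t $ k $ j)"
    and "1 \<le> n" and "1 \<le> mabs r"
  shows
    "(\<forall>N\<ge>1.
        integrable M (\<lambda>\<omega>. mpow (eff_noise u G W t0 h x0 n \<omega>) r) \<and>
        (\<forall>s. mabs s \<le> N \<longrightarrow> integrable M (\<lambda>\<omega>. mpow (noise_incr W t0 h n \<omega>) s)) \<and>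
        (\<forall>r'. mabs r' \<le> N \<longrightarrow> integrable M (\<lambda>\<omega>. mpow (eff_noise u G W t0 h x0 (n - 1) \<omega>) r'))
        \<longrightarrow>
        integrable M (noise_remainder u G W t0 h x0 r n N) \<and>
        (\<integral>\<omega>. mpow (eff_noise u G W t0 h x0 n \<omega>) r \<partial>M) =
          (\<Sum>(s, r') | 1 \<le> mabs s + mabs r' \<and> mabs s + mabs r' \<le> N.
             noise_coeff u G h N r s r' (central_part u t0 h x0 (n - 1)) (grid t0 h (n - 1))
             * (\<integral>\<omega>. mpow (noise_incr W t0 h n \<omega>) s \<partial>M)
             * (\<integral>\<omega>. mpow (eff_noise u G W t0 h x0 (n - 1) \<omega>) r' \<partial>M))
          + (\<integral>\<omega>. noise_remainder u G W t0 h x0 r n N \<omega> \<partial>M))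
     \<and>
     (\<forall>(A :: nat \<Rightarrow> 'd \<Rightarrow> real) \<rho>.
        (\<forall>m\<ge>1. \<forall>j. AE \<omega> in M. \<bar>noise_incr W t0 h m \<omega> $ j\<bar> < A m j) \<and>
        (\<forall>k. AE \<omega> in M. \<bar>eff_noise u G W t0 h x0 (n - 1) \<omega> $ k\<bar> \<le> \<rho> $ k) \<and>
        (\<forall>k. taylor_converges_on_box (\<lambda>x. u x (grid t0 h (n - 1)) $ k)
               (central_part u t0 h x0 (n - 1)) \<rho>) \<and>
        (\<forall>k j. taylor_converges_on_box (\<lambda>x. G x (grid t0 h (n - 1)) $ k $ j)
               (central_part u t0 h x0 (n - 1)) \<rho>)
        \<longrightarrow>
        (\<forall>N. integrable M (noise_remainder u G W t0 h x0 r n N)) \<and>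
        (\<lambda>N. \<integral>\<omega>. noise_remainder u G W t0 h x0 r n N \<omega> \<partial>M) \<longlonglongrightarrow> 0)"
proof -
  have grid_nonneg: "0 \<le> grid t0 h i" for i
    using assms(4,5) by (simp add: grid_def)
  have cont_u: "\<And>i k. continuous_on UNIV (\<lambda>x. u x (grid t0 h i) $ k)"
    by (intro smooth_fun_imp_continuous assms(6) grid_nonneg)
  have cont_G: "\<And>i k j. continuous_on UNIV (\<lambda>x. G x (grid t0 h i) $ k $ j)"
    by (intro smooth_fun_imp_continuous assms(7) grid_nonneg)
  have indep: "\<And>s q. prob_space.indep_var M borel (\<lambda>\<omega>. mpow (noise_incr W t0 h n \<omega>) s)
      borel (\<lambda>\<omega>. mpow (eff_noise u G W t0 h x0 (n - 1) \<omega>) q)"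
    by (rule indep_noise_incr_eff_noise) (use assms(1,3,4,5,8) cont_u cont_G in auto)
  have meas: "\<And>N. noise_remainder u G W t0 h x0 r n N \<in> borel_measurable M"
    by (rule noise_remainder_measurable) (use assms(2,4,5) cont_u cont_G in auto)
  show ?thesis
  proof (rule conjI; intro allI impI; elim conjE)
    fix N :: nat
    assume "1 \<le> N"
      and int: "integrable M (\<lambda>\<omega>. mpow (eff_noise u G W t0 h x0 n \<omega>) r)"
        "\<forall>s. mabs s \<le> N \<longrightarrow> integrable M (\<lambda>\<omega>. mpow (noise_incr W t0 h n \<omega>) s)"
        "\<forall>r'. mabs r' \<le> N \<longrightarrow> integrable M (\<lambda>\<omega>. mpow (eff_noise u G W t0 h x0 (n - 1) \<omega>) r')"
    show "integrable M (noise_remainder u G W t0 h x0 r n N) \<and>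
        (\<integral>\<omega>. mpow (eff_noise u G W t0 h x0 n \<omega>) r \<partial>M) =
          (\<Sum>(s, r') | 1 \<le> mabs s + mabs r' \<and> mabs s + mabs r' \<le> N.
             noise_coeff u G h N r s r' (central_part u t0 h x0 (n - 1)) (grid t0 h (n - 1))
             * (\<integral>\<omega>. mpow (noise_incr W t0 h n \<omega>) s \<partial>M)
             * (\<integral>\<omega>. mpow (eff_noise u G W t0 h x0 (n - 1) \<omega>) r' \<partial>M))
          + (\<integral>\<omega>. noise_remainder u G W t0 h x0 r n N \<omega> \<partial>M)"
      by (intro conjI expectation_of_expansion[OF assms(1) indep int(1)]) (use int(2,3) in auto)
  next
    fix A :: "nat \<Rightarrow> 'd \<Rightarrow> real" and \<rho> :: "real ^ 'v"
    assume A: "\<forall>m\<ge>1. \<forall>j. AE \<omega> in M. \<bar>noise_incr W t0 h m \<omega> $ j\<bar> < A m j"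
      and box: "\<forall>k. AE \<omega> in M. \<bar>eff_noise u G W t0 h x0 (n - 1) \<omega> $ k\<bar> \<le> \<rho> $ k"
        "\<forall>k. taylor_converges_on_box (\<lambda>x. u x (grid t0 h (n - 1)) $ k)
           (central_part u t0 h x0 (n - 1)) \<rho>"
        "\<forall>k j. taylor_converges_on_box (\<lambda>x. G x (grid t0 h (n - 1)) $ k $ j)
           (central_part u t0 h x0 (n - 1)) \<rho>"
    have "AE \<omega> in M. \<bar>noise_incr W t0 h n \<omega> $ j\<bar> \<le> (\<chi> j. A n j) $ j" for j
    proof -
      have "AE \<omega> in M. \<bar>noise_incr W t0 h n \<omega> $ j\<bar> < A n j"
        using A assms(8) by blast
      then show ?thesis
        by eventually_elim simp
    qed
    note lim = expectation_of_remainder_tendsto_0[OF assms(1,8,9) meas this box[rule_format]]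
    show "(\<forall>N. integrable M (noise_remainder u G W t0 h x0 r n N)) \<and>
        (\<lambda>N. \<integral>\<omega>. noise_remainder u G W t0 h x0 r n N \<omega> \<partial>M) \<longlonglongrightarrow> 0"
      using lim by blast
  qed
qed

end
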